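(* Let $X=\ell_p$ with $1\le p<\infty$, or $X=c_0$ (complex sequence spaces indexed by $\mathbb Z_+$). Then a typical $T\in(\mathcal B_1(X),\mathrm{SOT})$ has the following properties: $T-\lambda$ has dense range for every $\lambda\in\mathbb C$, and $\sigma(T)=\sigma_{ap}(T)=\overline{\mathbb D}$.
   Context: $\mathcal B_1(X)$ is the set of all bounded linear operators $T$ on $X$ with $\|T\|\le 1$. SOT (Strong Operator Topology) is the topology of pointwise norm convergence: $T_i\to T$ iff $\|T_ix-Tx\|\to0$ for all $x\in X$; $(\mathcal B_1(X),\mathrm{SOT})$ is a Polish space. "A typical $T\in(\mathcal B_1(X),\mathrm{SOT})$ satisfies (P)" means that the set of $T\in\mathcal B_1(X)$ satisfying (P) is comeager, i.e. contains a dense $G_\delta$ subset of $(\mathcal B_1(X),\mathrm{SOT})$. $\mathbb D$ is the open unit disk in $\mathbb C$, $\sigma(T)$ is the spectrum of $T$, and $\sigma_{ap}(T)$ is the approximate point spectrum, i.e. the set of $\lambda\in\mathbb C$ such that $T-\lambda$ is not bounded below. *)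

theory Defs
  imports "HOL-Analysis.Analysis"
begin

text \<open>
  The exponent \<open>p\<close> is a variable, so the sequence spaces are carrier sets of functions
  \<^typ>\<open>nat \<Rightarrow> complex\<close>.  A normed sequence space is given by its carrier \<open>X\<close> and its norm \<open>N\<close>,
  the latter being meaningful only on \<open>X\<close>.
\<close>

definition lp_space :: "real \<Rightarrow> (nat \<Rightarrow> complex) set" where
  "lp_space p = {x. summable (\<lambda>n. norm (x n) powr p)}"

definition lp_norm :: "real \<Rightarrow> (nat \<Rightarrow> complex) \<Rightarrow> real" where
  "lp_norm p x = (\<Sum>n. norm (x n) powr p) powr (1 / p)"

definition c0_space :: "(nat \<Rightarrow> complex) set" where
  "c0_space = {x. x \<longlonglongrightarrow> 0}"

definition c0_norm :: "(nat \<Rightarrow> complex) \<Rightarrow> real" where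
  "c0_norm x = (SUP n. norm (x n))"

text \<open>
  The value 0 off the carrier is needed because \<^locale>\<open>Metric_space\<close> requires nonnegativity
  and symmetry of the distance for all arguments, and \<^const>\<open>c0_norm\<close> has no known sign
  on unbounded sequences.
\<close>

definition norm_dist ::
    "(nat \<Rightarrow> complex) set \<Rightarrow> ((nat \<Rightarrow> complex) \<Rightarrow> real) \<Rightarrow>
     (nat \<Rightarrow> complex) \<Rightarrow> (nat \<Rightarrow> complex) \<Rightarrow> real" where
  "norm_dist X N x y = (if x \<in> X \<and> y \<in> X then N (\<lambda>n. x n - y n) else 0)"

definition norm_topology ::
    "(nat \<Rightarrow> complex) set \<Rightarrow> ((nat \<Rightarrow> complex) \<Rightarrow> real) \<Rightarrow> (nat \<Rightarrow> complex) topology" where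
  "norm_topology X N = Metric_space.mtopology X (norm_dist X N)"

text \<open>
  Operators on \<open>X\<close> are extensional functions, so that an operator is determined by its values
  on \<open>X\<close>.
\<close>

definition bounded_operators ::
    "(nat \<Rightarrow> complex) set \<Rightarrow> ((nat \<Rightarrow> complex) \<Rightarrow> real) \<Rightarrow>
     ((nat \<Rightarrow> complex) \<Rightarrow> (nat \<Rightarrow> complex)) set" where
  "bounded_operators X N =
     {T \<in> X \<rightarrow>\<^sub>E X.
        (\<forall>x\<in>X. \<forall>y\<in>X. T (\<lambda>n. x n + y n) = (\<lambda>n. T x n + T y n)) \<and>
        (\<forall>c. \<forall>x\<in>X. T (\<lambda>n. c * x n) = (\<lambda>n. c * T x n)) \<and>
        (\<exists>C. \<forall>x\<in>X. N (T x) \<le> C * N x)}"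

definition op_norm ::
    "(nat \<Rightarrow> complex) set \<Rightarrow> ((nat \<Rightarrow> complex) \<Rightarrow> real) \<Rightarrow>
     ((nat \<Rightarrow> complex) \<Rightarrow> (nat \<Rightarrow> complex)) \<Rightarrow> real" where
  "op_norm X N T = (SUP x \<in> {x \<in> X. N x \<le> 1}. N (T x))"

definition contractions ::
    "(nat \<Rightarrow> complex) set \<Rightarrow> ((nat \<Rightarrow> complex) \<Rightarrow> real) \<Rightarrow>
     ((nat \<Rightarrow> complex) \<Rightarrow> (nat \<Rightarrow> complex)) set" where
  "contractions X N = {T \<in> bounded_operators X N. op_norm X N T \<le> 1}"

text \<open>Pointwise norm convergence is the product topology, indexed by the vectors of \<open>X\<close>.\<close>

definition sot_contractions ::
    "(nat \<Rightarrow> complex) set \<Rightarrow> ((nat \<Rightarrow> complex) \<Rightarrow> real) \<Rightarrow>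
     ((nat \<Rightarrow> complex) \<Rightarrow> (nat \<Rightarrow> complex)) topology" where
  "sot_contractions X N =
     subtopology (product_topology (\<lambda>_. norm_topology X N) X) (contractions X N)"

definition comeager_in :: "'a topology \<Rightarrow> 'a set \<Rightarrow> bool" where
  "comeager_in \<T> S \<longleftrightarrow>
     S \<subseteq> topspace \<T> \<and>
     (\<exists>G. G \<subseteq> S \<and> gdelta_in \<T> G \<and> \<T> closure_of G = topspace \<T>)"

definition typical_contraction ::
    "(nat \<Rightarrow> complex) set \<Rightarrow> ((nat \<Rightarrow> complex) \<Rightarrow> real) \<Rightarrow>
     (((nat \<Rightarrow> complex) \<Rightarrow> (nat \<Rightarrow> complex)) \<Rightarrow> bool) \<Rightarrow> bool" where
  "typical_contraction X N P \<longleftrightarrow>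
     comeager_in (sot_contractions X N) {T \<in> contractions X N. P T}"

definition minus_scalar ::
    "(nat \<Rightarrow> complex) set \<Rightarrow> ((nat \<Rightarrow> complex) \<Rightarrow> (nat \<Rightarrow> complex)) \<Rightarrow> complex \<Rightarrow>
     (nat \<Rightarrow> complex) \<Rightarrow> (nat \<Rightarrow> complex)" where
  "minus_scalar X T \<mu> = (\<lambda>x\<in>X. \<lambda>n. T x n - \<mu> * x n)"

definition dense_range ::
    "(nat \<Rightarrow> complex) set \<Rightarrow> ((nat \<Rightarrow> complex) \<Rightarrow> real) \<Rightarrow>
     ((nat \<Rightarrow> complex) \<Rightarrow> (nat \<Rightarrow> complex)) \<Rightarrow> bool" where
  "dense_range X N A \<longleftrightarrow> norm_topology X N closure_of (A ` X) = X"

definition invertible_operator ::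
    "(nat \<Rightarrow> complex) set \<Rightarrow> ((nat \<Rightarrow> complex) \<Rightarrow> real) \<Rightarrow>
     ((nat \<Rightarrow> complex) \<Rightarrow> (nat \<Rightarrow> complex)) \<Rightarrow> bool" where
  "invertible_operator X N A \<longleftrightarrow>
     (\<exists>B \<in> bounded_operators X N. \<forall>x\<in>X. B (A x) = x \<and> A (B x) = x)"

definition bounded_below ::
    "(nat \<Rightarrow> complex) set \<Rightarrow> ((nat \<Rightarrow> complex) \<Rightarrow> real) \<Rightarrow>
     ((nat \<Rightarrow> complex) \<Rightarrow> (nat \<Rightarrow> complex)) \<Rightarrow> bool" where
  "bounded_below X N A \<longleftrightarrow> (\<exists>c>0. \<forall>x\<in>X. c * N x \<le> N (A x))"

definition op_spectrum ::
    "(nat \<Rightarrow> complex) set \<Rightarrow> ((nat \<Rightarrow> complex) \<Rightarrow> real) \<Rightarrow>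
     ((nat \<Rightarrow> complex) \<Rightarrow> (nat \<Rightarrow> complex)) \<Rightarrow> complex set" where
  "op_spectrum X N T = {\<mu>. \<not> invertible_operator X N (minus_scalar X T \<mu>)}"

definition approx_point_spectrum ::
    "(nat \<Rightarrow> complex) set \<Rightarrow> ((nat \<Rightarrow> complex) \<Rightarrow> real) \<Rightarrow>
     ((nat \<Rightarrow> complex) \<Rightarrow> (nat \<Rightarrow> complex)) \<Rightarrow> complex set" where
  "approx_point_spectrum X N T = {\<mu>. \<not> bounded_below X N (minus_scalar X T \<mu>)}"

end

theory Submission
  imports Defs
begin

text \<open>
  The contractions with the strong operator topology form a complete metric space, so by Baire it
  suffices to write the property as a countable intersection of dense open sets.  Since
  \<open>T\<^sup>k u - \<mu>\<^sup>k u\<close> always lies in the range of \<open>T - \<mu>\<close>, that range is dense for all \<open>\<mu>\<close> at once if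
  for every basis vector \<open>e\<close> and every \<open>\<epsilon> > 0\<close> one has \<open>\<parallel>T\<^sup>k e\<parallel> < \<epsilon>\<close> for some \<open>k\<close> (this serves
  \<open>\<bar>\<mu>\<bar> \<ge> 1\<close>), and for every \<open>s < 1\<close> there are \<open>k\<close> and \<open>u\<close> with \<open>\<parallel>T\<^sup>k u - e\<parallel> < \<epsilon>\<close> and
  \<open>s\<^sup>k \<parallel>u\<parallel> < \<epsilon>\<close> (this serves \<open>\<bar>\<mu>\<bar> \<le> s\<close>).  These conditions are open, and they hold for the
  operators \<open>(1 - \<delta>) P\<^sub>n T\<^sub>0 P\<^sub>n\<close> plus a backward shift by \<open>n\<close> places, damped by \<open>\<delta>\<close> where it enters
  the first \<open>n\<close> coordinates; these approximate any contraction \<open>T\<^sub>0\<close>.  Likewise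
  \<open>(1 - \<delta>) P\<^sub>n T\<^sub>0 P\<^sub>n + \<nu> (I - P\<^sub>n)\<close> makes \<open>\<nu>\<close> an eigenvalue for \<open>\<bar>\<nu>\<bar> \<le> 1\<close>, and the approximate point
  spectrum is closed, so a countable dense set of \<open>\<nu>\<close> is enough.  The spectrum adds nothing
  outside the disc, because an operator with dense range that is bounded below is invertible.
\<close>

section \<open>Solid shift-invariant sequence spaces\<close>

definition unit_seq :: "nat \<Rightarrow> nat \<Rightarrow> complex" where
  "unit_seq j = (\<lambda>i. if i = j then 1 else 0)"

text \<open>This is the coordinate projection \<open>P\<^sub>n\<close> of the introduction;
  \<open>tail n\<close> is the complementary projection \<open>I - P\<^sub>n\<close>.\<close>

definition head :: "nat \<Rightarrow> (nat \<Rightarrow> complex) \<Rightarrow> nat \<Rightarrow> complex" where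
  "head n x = (\<lambda>i. if i < n then x i else 0)"

definition tail :: "nat \<Rightarrow> (nat \<Rightarrow> complex) \<Rightarrow> nat \<Rightarrow> complex" where
  "tail n x = (\<lambda>i. if i < n then 0 else x i)"

text \<open>The axioms collect what the lp spaces and c0 share. \<open>norm_tail\<close> makes the
  finitely supported sequences dense. \<open>norm_disjoint_add\<close> stands in for the formulas
  special to each norm (a sum of p-th powers, a maximum): for disjoint supports, the norm of a sum
  is a monotone function of the norms of the two summands. All constructed operators are shown to be
  contractions through it.\<close>

locale sequence_space =
  fixes X :: "(nat \<Rightarrow> complex) set" and N :: "(nat \<Rightarrow> complex) \<Rightarrow> real"
  assumes unit_mem: "unit_seq j \<in> X"
    and add_mem: "\<lbrakk>x \<in> X; y \<in> X\<rbrakk> \<Longrightarrow> (\<lambda>n. x n + y n) \<in> X"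
    and scale_mem: "x \<in> X \<Longrightarrow> (\<lambda>n. c * x n) \<in> X"
    and norm_nonneg: "x \<in> X \<Longrightarrow> 0 \<le> N x"
    and norm_eq_0: "\<lbrakk>x \<in> X; N x = 0\<rbrakk> \<Longrightarrow> x = (\<lambda>_. 0)"
    and norm_scale: "x \<in> X \<Longrightarrow> N (\<lambda>n. c * x n) = norm c * N x"
    and norm_add: "\<lbrakk>x \<in> X; y \<in> X\<rbrakk> \<Longrightarrow> N (\<lambda>n. x n + y n) \<le> N x + N y"
    and solid_mem: "\<lbrakk>y \<in> X; \<And>n. norm (x n) \<le> norm (y n)\<rbrakk> \<Longrightarrow> x \<in> X"
    and solid_norm: "\<lbrakk>y \<in> X; \<And>n. norm (x n) \<le> norm (y n)\<rbrakk> \<Longrightarrow> N x \<le> N y"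
    and norm_tail: "x \<in> X \<Longrightarrow> (\<lambda>n. N (tail n x)) \<longlonglongrightarrow> 0"
    and shift_right_mem: "x \<in> X \<Longrightarrow> (\<lambda>i. if i < m then 0 else x (i - m)) \<in> X"
    and shift_right_norm: "x \<in> X \<Longrightarrow> N (\<lambda>i. if i < m then 0 else x (i - m)) \<le> N x"
    and shift_left_mem: "x \<in> X \<Longrightarrow> (\<lambda>i. x (i + m)) \<in> X"
    and shift_left_norm: "x \<in> X \<Longrightarrow> N (\<lambda>i. x (i + m)) \<le> N x"
    and norm_disjoint_add:
      "\<lbrakk>u \<in> X; v \<in> X; u' \<in> X; v' \<in> X;
        \<And>i. u i = 0 \<or> v i = 0; \<And>i. u' i = 0 \<or> v' i = 0; N u \<le> N u'; N v \<le> N v'\<rbrakk>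
       \<Longrightarrow> N (\<lambda>i. u i + v i) \<le> N (\<lambda>i. u' i + v' i)"
    and complete: "\<lbrakk>\<And>n. \<sigma> n \<in> X;
        \<And>\<epsilon>. \<epsilon> > 0 \<Longrightarrow> \<exists>M. \<forall>m\<ge>M. \<forall>n\<ge>M. N (\<lambda>i. \<sigma> m i - \<sigma> n i) < \<epsilon>\<rbrakk>
       \<Longrightarrow> \<exists>x\<in>X. (\<lambda>n. N (\<lambda>i. \<sigma> n i - x i)) \<longlonglongrightarrow> 0"
begin

section \<open>Linear structure and the norm metric\<close>

lemma zero_mem: "(\<lambda>_. 0) \<in> X"
  by (rule solid_mem[OF unit_mem[of 0]]) simp

lemma norm_zero: "N (\<lambda>_. 0) = 0"
  using norm_scale[OF zero_mem, of 0] by simp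

lemma diff_mem: "\<lbrakk>x \<in> X; y \<in> X\<rbrakk> \<Longrightarrow> (\<lambda>n. x n - y n) \<in> X"
  using add_mem[OF _ scale_mem[of y "-1"]] by simp

lemma head_mem: "x \<in> X \<Longrightarrow> head n x \<in> X"
  by (rule solid_mem) (auto simp: head_def)

lemma tail_mem: "x \<in> X \<Longrightarrow> tail n x \<in> X"
  by (rule solid_mem) (auto simp: tail_def)

lemma norm_head_le: "x \<in> X \<Longrightarrow> N (head n x) \<le> N x"
  by (rule solid_norm) (auto simp: head_def)

lemma norm_diff_commute: "x \<in> X \<Longrightarrow> y \<in> X \<Longrightarrow> N (\<lambda>n. x n - y n) = N (\<lambda>n. y n - x n)"
  using norm_scale[OF diff_mem, of x y "-1"] by simp

lemma norm_diff_triangle: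
  assumes "x \<in> X" "y \<in> X" "z \<in> X"
  shows "N (\<lambda>n. x n - z n) \<le> N (\<lambda>n. x n - y n) + N (\<lambda>n. y n - z n)"
  using norm_add[OF diff_mem diff_mem, of x y y z] assms by simp

abbreviation D :: "(nat \<Rightarrow> complex) \<Rightarrow> (nat \<Rightarrow> complex) \<Rightarrow> real" where
  "D \<equiv> norm_dist X N"

lemma D_eq: "x \<in> X \<Longrightarrow> y \<in> X \<Longrightarrow> D x y = N (\<lambda>n. x n - y n)"
  by (simp add: norm_dist_def)

sublocale V: Metric_space X D
proof
  fix x y z
  show "0 \<le> D x y"
    by (simp add: norm_dist_def diff_mem norm_nonneg)
  show "D x y = D y x"
    using norm_diff_commute by (auto simp: norm_dist_def)
  show "D x y = 0 \<longleftrightarrow> x = y" if "x \<in> X" "y \<in> X"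
  proof
    assume "D x y = 0"
    then have "(\<lambda>n. x n - y n) = (\<lambda>_. 0)"
      using that by (auto simp: D_eq intro!: norm_eq_0 diff_mem)
    then show "x = y"
      by (metis eq_iff_diff_eq_0 ext)
  qed (use that in \<open>simp add: D_eq norm_zero\<close>)
  show "D x z \<le> D x y + D y z" if "x \<in> X" "y \<in> X" "z \<in> X"
    using that norm_diff_triangle by (simp add: D_eq)
qed

lemma D_zero: "x \<in> X \<Longrightarrow> D x (\<lambda>_. 0) = N x"
  by (simp add: D_eq zero_mem)

lemma D_add_le:
  assumes "x \<in> X" "y \<in> X" "x' \<in> X" "y' \<in> X"
  shows "D (\<lambda>i. x i + y i) (\<lambda>i. x' i + y' i) \<le> D x x' + D y y'"
proof -
  have "(\<lambda>i. x i + y i - (x' i + y' i)) = (\<lambda>i. (x i - x' i) + (y i - y' i))"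
    by auto
  then show ?thesis
    using assms norm_add[OF diff_mem diff_mem, of x x' y y'] by (simp add: D_eq add_mem)
qed

lemma D_scale:
  assumes "x \<in> X" "y \<in> X"
  shows "D (\<lambda>i. c * x i) (\<lambda>i. c * y i) = norm c * D x y"
  using assms norm_scale[OF diff_mem, of x y c] by (simp add: D_eq scale_mem right_diff_distrib)

lemma D_head: "x \<in> X \<Longrightarrow> D x (head n x) = N (tail n x)"
  by (auto simp: D_eq head_mem intro!: arg_cong[of _ _ N]) (auto simp: head_def tail_def)

lemma D_head_tendsto: "x \<in> X \<Longrightarrow> (\<lambda>n. D x (head n x)) \<longlonglongrightarrow> 0"
  by (simp add: D_head norm_tail)

lemma D_complete:
  assumes mem: "\<And>n. \<sigma> n \<in> X"
    and cauchy: "\<And>\<epsilon>. \<epsilon> > 0 \<Longrightarrow> \<exists>M. \<forall>m\<ge>M. \<forall>n\<ge>M. D (\<sigma> m) (\<sigma> n) < \<epsilon>"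
  obtains x where "x \<in> X" "(\<lambda>n. D (\<sigma> n) x) \<longlonglongrightarrow> 0"
  using complete[of \<sigma>] assms by (auto simp: D_eq)

lemma D_limit_unique:
  assumes "(\<lambda>n. D (\<sigma> n) x) \<longlonglongrightarrow> 0" "(\<lambda>n. D (\<sigma> n) y) \<longlonglongrightarrow> 0"
    and "\<And>n. \<sigma> n \<in> X" "x \<in> X" "y \<in> X"
  shows "x = y"
proof -
  have "(\<lambda>n. D (\<sigma> n) x + D (\<sigma> n) y) \<longlonglongrightarrow> 0"
    using tendsto_add[OF assms(1,2)] by simp
  then have "D x y \<le> 0"
    by (rule LIMSEQ_le_const) (use assms in \<open>auto simp: V.triangle''\<close>)
  then show ?thesis
    using assms V.nonneg[of x y] by (metis V.zero order_antisym)
qed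

section \<open>Linear contractions and their control by unit vectors\<close>

abbreviation contr where "contr \<equiv> contractions X N"

text \<open>Homogeneity carries the bound from the unit ball to all of \<open>X\<close>. This trades
  the supremum in \<open>op_norm\<close> for a pointwise inequality, the form used from here
  on.\<close>

lemma contractions_iff:
  "T \<in> contr \<longleftrightarrow> T \<in> X \<rightarrow>\<^sub>E X \<and>
     (\<forall>x\<in>X. \<forall>y\<in>X. T (\<lambda>n. x n + y n) = (\<lambda>n. T x n + T y n)) \<and>
     (\<forall>c. \<forall>x\<in>X. T (\<lambda>n. c * x n) = (\<lambda>n. c * T x n)) \<and>
     (\<forall>x\<in>X. N (T x) \<le> N x)" (is "_ \<longleftrightarrow> ?P \<and> ?add \<and> ?scale \<and> ?le")
proof
  assume T: "T \<in> contr"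
  then have lin: ?P ?add ?scale and "\<exists>C. \<forall>x\<in>X. N (T x) \<le> C * N x" and op: "op_norm X N T \<le> 1"
    by (auto simp: contractions_def bounded_operators_def)
  then obtain C where C: "N (T x) \<le> C * N x" if "x \<in> X" for x
    by blast
  \<comment> \<open>A real supremum bounds its members only when the set is bounded above, and
    boundedness of \<open>T\<close> provides this. The sign of \<open>C\<close> is not given, hence
    the absolute value.\<close>
  have "N (T x) \<le> \<bar>C\<bar>" if "x \<in> X" "N x \<le> 1" for x
  proof -
    have "C * N x \<le> \<bar>C\<bar> * N x"
      using that by (simp add: mult_right_mono norm_nonneg)
    also have "\<dots> \<le> \<bar>C\<bar> * 1"
      using that by (intro mult_left_mono) auto
    finally show ?thesis
      using C[OF that(1)] by simp
  qed
  then have bdd: "bdd_above ((\<lambda>x. N (T x)) ` {x \<in> X. N x \<le> 1})"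
    by (auto intro!: bdd_aboveI)
  have unit: "N (T x) \<le> 1" if "x \<in> X" "N x \<le> 1" for x
    using cSUP_upper[OF _ bdd, of x] that op by (auto simp: op_norm_def)
  have "N (T x) \<le> N x" if x: "x \<in> X" for x
  \<comment> \<open>A vector of norm 0 cannot be normalised; there the bound by \<open>C\<close>
    gives the claim directly.\<close>
  proof (cases "N x = 0")
    case True
    then show ?thesis
      using C[OF x] by simp
  next
    case False
    then have pos: "N x > 0"
      using norm_nonneg[OF x] by simp
    let ?c = "complex_of_real (1 / N x)"
    have "N (\<lambda>n. ?c * x n) = 1"
      using pos norm_scale[OF x, of ?c] by (simp add: norm_divide)
    then have "N (T (\<lambda>n. ?c * x n)) \<le> 1"
      by (intro unit scale_mem x) simp
    also have "T (\<lambda>n. ?c * x n) = (\<lambda>n. ?c * T x n)"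
      using lin(3) x by blast
    also have "N \<dots> = norm ?c * N (T x)"
      using lin(1) x by (intro norm_scale) auto
    finally show ?thesis
      using pos by (simp add: norm_divide field_simps)
  qed
  with lin show "?P \<and> ?add \<and> ?scale \<and> ?le"
    by blast
next
  assume R: "?P \<and> ?add \<and> ?scale \<and> ?le"
  have "op_norm X N T \<le> 1"
    unfolding op_norm_def
  proof (rule cSUP_least)
    show "{x \<in> X. N x \<le> 1} \<noteq> {}"
      using zero_mem norm_zero by force
  qed (use R in force)
  moreover have "\<exists>C. \<forall>x\<in>X. N (T x) \<le> C * N x"
    using R by (intro exI[of _ 1]) auto
  ultimately show "T \<in> contr"
    using R by (simp add: contractions_def bounded_operators_def)
qed

lemma contractionI:
  assumes "T \<in> X \<rightarrow>\<^sub>E X"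
    and "\<And>x y. \<lbrakk>x \<in> X; y \<in> X\<rbrakk> \<Longrightarrow> T (\<lambda>n. x n + y n) = (\<lambda>n. T x n + T y n)"
    and "\<And>c x. x \<in> X \<Longrightarrow> T (\<lambda>n. c * x n) = (\<lambda>n. c * T x n)"
    and "\<And>x. x \<in> X \<Longrightarrow> N (T x) \<le> N x"
  shows "T \<in> contr"
  unfolding contractions_iff by (intro conjI ballI allI assms)

context
  fixes T
  assumes T: "T \<in> contr"
begin

lemma contr_mem: "x \<in> X \<Longrightarrow> T x \<in> X"
  and contr_add: "\<lbrakk>x \<in> X; y \<in> X\<rbrakk> \<Longrightarrow> T (\<lambda>n. x n + y n) = (\<lambda>n. T x n + T y n)"
  and contr_scale: "x \<in> X \<Longrightarrow> T (\<lambda>n. c * x n) = (\<lambda>n. c * T x n)"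
  and contr_norm: "x \<in> X \<Longrightarrow> N (T x) \<le> N x"
  and contr_undefined: "x \<notin> X \<Longrightarrow> T x = undefined"
  using T unfolding contractions_iff by (blast, blast, blast, blast, metis PiE_arb)

lemma contr_diff: "\<lbrakk>x \<in> X; y \<in> X\<rbrakk> \<Longrightarrow> T (\<lambda>n. x n - y n) = (\<lambda>n. T x n - T y n)"
  using contr_add[OF _ scale_mem[of y "-1"]] contr_scale[of y "-1"] by simp

lemma contr_zero: "T (\<lambda>_. 0) = (\<lambda>_. 0)"
  using contr_scale[OF zero_mem, of 0] by simp

lemma contr_D: "\<lbrakk>x \<in> X; y \<in> X\<rbrakk> \<Longrightarrow> D (T x) (T y) \<le> D x y"
  using contr_norm[OF diff_mem, of x y] by (simp add: D_eq contr_mem contr_diff)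

lemma funpow_mem: "x \<in> X \<Longrightarrow> (T ^^ k) x \<in> X"
  by (induction k) (auto simp: contr_mem)

lemma funpow_scale: "x \<in> X \<Longrightarrow> (T ^^ k) (\<lambda>n. c * x n) = (\<lambda>n. c * (T ^^ k) x n)"
  by (induction k) (auto simp: contr_scale funpow_mem)

end

lemma head_Suc: "head (Suc n) x = (\<lambda>i. head n x i + x n * unit_seq n i)"
  by (auto simp: head_def unit_seq_def less_Suc_eq)

lemma contr_ext_head:
  assumes T: "T \<in> contr" and S: "S \<in> contr" and x: "x \<in> X"
  shows "D (T (head n x)) (S (head n x)) \<le> (\<Sum>j<n. norm (x j) * D (T (unit_seq j)) (S (unit_seq j)))"
proof (induction n)
  case 0
  have "head 0 x = (\<lambda>_. 0)"
    by (simp add: head_def)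
  then show ?case
    by (simp add: contr_zero[OF T] contr_zero[OF S] zero_mem)
next
  case (Suc n)
  have eq: "R (head (Suc n) x) = (\<lambda>i. R (head n x) i + x n * R (unit_seq n) i)" if "R \<in> contr" for R
    unfolding head_Suc
    by (simp add: contr_add[OF that] contr_scale[OF that] head_mem scale_mem unit_mem x)
  have "D (T (head (Suc n) x)) (S (head (Suc n) x))
      \<le> D (T (head n x)) (S (head n x)) + norm (x n) * D (T (unit_seq n)) (S (unit_seq n))"
    unfolding eq[OF T] eq[OF S]
    by (intro order_trans[OF D_add_le])
       (auto simp: D_scale contr_mem T S x head_mem scale_mem unit_mem)
  with Suc show ?case
    by simp
qed

text \<open>Replacing \<open>x\<close> by its head costs the tail norm once for each operator, since
  both are nonexpansive; on the head linearity leaves only finitely many unit vectors. Hence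
  pointwise convergence of contractions need only be checked on unit vectors.\<close>

lemma contr_diff_le:
  assumes T: "T \<in> contr" and S: "S \<in> contr" and x: "x \<in> X"
  shows "D (T x) (S x) \<le>
    2 * D x (head n x) + (\<Sum>j<n. norm (x j) * D (T (unit_seq j)) (S (unit_seq j)))"
proof -
  have h: "head n x \<in> X"
    by (simp add: head_mem x)
  have "D (T x) (S x) \<le> D (T x) (T (head n x)) + (D (T (head n x)) (S (head n x)) + D (S (head n x)) (S x))"
    by (meson T S x h contr_mem V.triangle add_left_mono order_trans)
  also have "D (T x) (T (head n x)) \<le> D x (head n x)"
    by (rule contr_D[OF T x h])
  also have "D (S (head n x)) (S x) \<le> D x (head n x)"
    using contr_D[OF S h x] by (simp add: V.commute)
  also have "D (T (head n x)) (S (head n x)) \<le> (\<Sum>j<n. norm (x j) * D (T (unit_seq j)) (S (unit_seq j)))"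
    by (rule contr_ext_head[OF assms])
  finally show ?thesis
    by simp
qed

end

section \<open>The strong operator topology on the contractions\<close>

context sequence_space
begin

text \<open>The cap \<open>1 / (j + 1)\<close> keeps the supremum finite and lets only finitely many
  unit vectors influence a ball of given radius.\<close>

definition sot_dist ::
    "((nat \<Rightarrow> complex) \<Rightarrow> nat \<Rightarrow> complex) \<Rightarrow> ((nat \<Rightarrow> complex) \<Rightarrow> nat \<Rightarrow> complex) \<Rightarrow> real" where
  "sot_dist T S = (SUP j. min (inverse (real (Suc j))) (D (T (unit_seq j)) (S (unit_seq j))))"

lemma sot_dist_upper:
  "min (inverse (real (Suc j))) (D (T (unit_seq j)) (S (unit_seq j))) \<le> sot_dist T S"
proof -
  have "min (inverse (real (Suc i))) (D (T (unit_seq i)) (S (unit_seq i))) \<le> 1" for i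
    by (simp add: min_le_iff_disj field_simps)
  then show ?thesis
    unfolding sot_dist_def by (intro cSUP_upper bdd_aboveI2[where M = 1]) auto
qed

lemma sot_dist_least:
  "(\<And>j. min (inverse (real (Suc j))) (D (T (unit_seq j)) (S (unit_seq j))) \<le> r) \<Longrightarrow> sot_dist T S \<le> r"
  unfolding sot_dist_def by (rule cSUP_least) auto

lemma sot_dist_nonneg: "0 \<le> sot_dist T S"
  by (rule order_trans[OF _ sot_dist_upper[of 0]]) simp

text \<open>Indices from \<open>m\<close> on contribute at most \<open>1 / (m + 1)\<close>, which is
  below \<open>r / 2\<close>. Half of \<open>r\<close> is used because a supremum of strict bounds
  is only bounded weakly. The number \<open>m\<close> depends on \<open>r\<close> alone.\<close>

lemma sot_dist_lessI:
  assumes "r > 0"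
  shows "\<exists>m. \<forall>T S. (\<forall>j<m. D (T (unit_seq j)) (S (unit_seq j)) < r / 2) \<longrightarrow> sot_dist T S < r"
proof -
  obtain m where m: "inverse (real (Suc m)) < r / 2"
    using reals_Archimedean[of "r / 2"] assms by auto
  have "sot_dist T S < r" if "\<And>j. j < m \<Longrightarrow> D (T (unit_seq j)) (S (unit_seq j)) < r / 2" for T S
  proof -
    have "min (inverse (real (Suc j))) (D (T (unit_seq j)) (S (unit_seq j))) \<le> r / 2" for j
    proof (cases "j < m")
      case True
      then show ?thesis
        using that[of j] by (simp add: min_le_iff_disj)
    next
      case False
      then have "inverse (real (Suc j)) \<le> inverse (real (Suc m))"
        by (intro le_imp_inverse_le) auto
      then have "inverse (real (Suc j)) \<le> r / 2"
        using m by linarith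
      then show ?thesis
        by (rule min.coboundedI1)
    qed
    then have "sot_dist T S \<le> r / 2"
      by (rule sot_dist_least)
    then show ?thesis
      using assms by simp
  qed
  then show ?thesis
    by blast
qed

text \<open>Evaluation at \<open>x\<close> is uniformly continuous on the contractions:
  \<open>r\<close> depends only on \<open>x\<close> and \<open>\<epsilon>\<close>. This uniformity
  also turns Cauchy sequences of operators into pointwise Cauchy sequences.\<close>

lemma sot_dist_eval:
  assumes x: "x \<in> X" and "\<epsilon> > 0"
  shows "\<exists>r>0. \<forall>T\<in>contr. \<forall>S\<in>contr. sot_dist T S < r \<longrightarrow> D (T x) (S x) < \<epsilon>"
proof -
  have "\<forall>\<^sub>F n in sequentially. D x (head n x) < \<epsilon> / 4"
    using order_tendstoD(2)[OF D_head_tendsto[OF x], of "\<epsilon> / 4"] \<open>\<epsilon> > 0\<close> by simp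
  then obtain n where n: "D x (head n x) < \<epsilon> / 4"
    by (auto simp: eventually_sequentially)
  define K where "K = (\<Sum>j<n. norm (x j))"
  have K: "K \<ge> 0"
    by (simp add: K_def sum_nonneg)
  \<comment> \<open>The first entry keeps the caps with \<open>j < n\<close> from being the smaller
    term, so that \<open>sot_dist\<close> really bounds the distances there; the second makes the
    weighted sum at most \<open>\<epsilon> / 2\<close>, with \<open>K + 1\<close> avoiding a zero
    denominator.\<close>
  define r where "r = min (inverse (real (Suc n))) (\<epsilon> / (2 * (K + 1)))"
  have "r > 0"
    using \<open>\<epsilon> > 0\<close> K by (simp add: r_def)
  moreover have "D (T x) (S x) < \<epsilon>" if T: "T \<in> contr" and S: "S \<in> contr" and less: "sot_dist T S < r" for T S
  proof -
    have "D (T (unit_seq j)) (S (unit_seq j)) \<le> r" if "j < n" for j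
    proof -
      have "r \<le> inverse (real (Suc n))"
        by (simp add: r_def)
      also have "\<dots> \<le> inverse (real (Suc j))"
        using that by (intro le_imp_inverse_le) auto
      finally show ?thesis
        using sot_dist_upper[of j T S] less by linarith
    qed
    then have "(\<Sum>j<n. norm (x j) * D (T (unit_seq j)) (S (unit_seq j))) \<le> (\<Sum>j<n. norm (x j) * r)"
      by (intro sum_mono mult_left_mono) auto
    also have "\<dots> = K * r"
      by (simp add: K_def sum_distrib_right)
    also have "\<dots> \<le> K * (\<epsilon> / (2 * (K + 1)))"
      using K by (intro mult_left_mono) (simp_all add: r_def)
    also have "\<dots> \<le> \<epsilon> / 2"
      using K \<open>\<epsilon> > 0\<close> by (simp add: field_simps)
    finally show ?thesis
      using contr_diff_le[OF T S x, of n] n by simp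
  qed
  ultimately show ?thesis
    by blast
qed

sublocale C: Metric_space contr sot_dist
proof
  fix T S R
  show "0 \<le> sot_dist T S"
    by (rule sot_dist_nonneg)
  show "sot_dist T S = sot_dist S T"
    by (simp add: sot_dist_def V.commute)
  show "sot_dist T S = 0 \<longleftrightarrow> T = S" if T: "T \<in> contr" and S: "S \<in> contr"
  proof
    assume 0: "sot_dist T S = 0"
    \<comment> \<open>On \<open>X\<close> the distance 0 is below every radius from
      \<open>sot_dist_eval\<close>; off \<open>X\<close> both operators are \<open>undefined\<close>
      by extensionality.\<close>
    have "T x = S x" for x
    proof (cases "x \<in> X")
      case True
      have "D (T x) (S x) < \<epsilon>" if "\<epsilon> > 0" for \<epsilon>
        using sot_dist_eval[OF True that] 0 T S by metis
      then show ?thesis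
        using True T S by (metis V.mdist_pos_less contr_mem less_irrefl)
    qed (simp add: contr_undefined T S)
    then show "T = S"
      by blast
  next
    assume "T = S"
    then show "sot_dist T S = 0"
      using S by (simp add: sot_dist_def contr_mem unit_mem)
  qed
  show "sot_dist T R \<le> sot_dist T S + sot_dist S R" if "T \<in> contr" "S \<in> contr" "R \<in> contr"
  proof (rule sot_dist_least)
    fix j
    have "D (T (unit_seq j)) (R (unit_seq j)) \<le> D (T (unit_seq j)) (S (unit_seq j)) + D (S (unit_seq j)) (R (unit_seq j))"
      using that by (intro V.triangle) (auto simp: contr_mem unit_mem)
    moreover have "0 \<le> D (T (unit_seq j)) (S (unit_seq j))" "0 \<le> D (S (unit_seq j)) (R (unit_seq j))"
      "0 \<le> inverse (real (Suc j))"
      by auto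
    ultimately show "min (inverse (real (Suc j))) (D (T (unit_seq j)) (R (unit_seq j))) \<le> sot_dist T S + sot_dist S R"
      using sot_dist_upper[of j T S] sot_dist_upper[of j S R] by linarith
  qed
qed

section \<open>The metric induces the strong operator topology and is complete\<close>

lemma topspace_sot: "topspace (sot_contractions X N) = contr"
  by (auto simp: sot_contractions_def norm_topology_def contractions_iff)

lemma continuous_map_sot_eval:
  assumes "x \<in> X"
  shows "continuous_map (sot_contractions X N) V.mtopology (\<lambda>T. T x)"
  unfolding sot_contractions_def norm_topology_def
  using assms by (intro continuous_map_from_subtopology continuous_map_product_projection)

text \<open>Evaluations are continuous for \<open>sot_dist\<close>, so the metric topology is at
  least as fine; conversely each ball contains a product neighbourhood that restricts only the first
  \<open>m\<close> unit vectors.\<close>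

lemma sot_contractions_eq: "sot_contractions X N = C.mtopology"
proof (rule topology_eq[THEN iffD2], intro allI iffI)
  fix U
  assume U: "openin (sot_contractions X N) U"
  have "continuous_map C.mtopology V.mtopology (\<lambda>T. T x)" if x: "x \<in> X" for x
    unfolding C.metric_continuous_map[OF V.Metric_space_axioms]
  proof (intro conjI ballI allI impI)
    show "(\<lambda>T. T x) ` contr \<subseteq> X"
      using x contr_mem by auto
    fix T and \<epsilon> :: real
    assume "T \<in> contr" "0 < \<epsilon>"
    then show "\<exists>\<delta>>0. \<forall>S. S \<in> contr \<and> sot_dist T S < \<delta> \<longrightarrow> D (T x) (S x) < \<epsilon>"
      using sot_dist_eval[OF x \<open>0 < \<epsilon>\<close>] by metis
  qed
  \<comment> \<open>Continuity into a product is checked coordinatewise, and the coordinates are the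
    evaluations; so the identity is continuous.\<close>
  then have "continuous_map C.mtopology (sot_contractions X N) (\<lambda>T. T)"
    unfolding sot_contractions_def norm_topology_def
    by (auto simp: continuous_map_in_subtopology continuous_map_componentwise contractions_iff PiE_iff)
  then have "openin C.mtopology {T \<in> topspace C.mtopology. T \<in> U}"
    using U by (rule openin_continuous_map_preimage)
  moreover have "{T \<in> topspace C.mtopology. T \<in> U} = U"
    using openin_subset[OF U] topspace_sot by auto
  ultimately show "openin C.mtopology U"
    by simp
next
  fix U
  assume "openin C.mtopology U"
  then have U: "U \<subseteq> contr" "\<And>T. T \<in> U \<Longrightarrow> \<exists>r>0. C.mball T r \<subseteq> U"
    by (auto simp: C.openin_mtopology)
  show "openin (sot_contractions X N) U"
  proof (subst openin_subopen, intro ballI)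
    fix T
    assume T: "T \<in> U"
    then obtain r where r: "r > 0" "C.mball T r \<subseteq> U"
      using U by blast
    obtain m where m: "\<forall>T S. (\<forall>j<m. D (T (unit_seq j)) (S (unit_seq j)) < r / 2) \<longrightarrow> sot_dist T S < r"
      using sot_dist_lessI[OF r(1)] by blast
    define W where "W j = {S \<in> topspace (sot_contractions X N). S (unit_seq j) \<in> V.mball (T (unit_seq j)) (r / 2)}" for j
    have W: "openin (sot_contractions X N) (W j)" for j
      unfolding W_def
      by (rule openin_continuous_map_preimage[OF continuous_map_sot_eval[OF unit_mem] V.openin_mball])
    \<comment> \<open>Intersecting with the whole space gives the right open set also for
      \<open>m = 0\<close>, where the family of conditions is empty.\<close>
    define V' where "V' = topspace (sot_contractions X N) \<inter> (\<Inter>j\<in>{..<m}. W j)"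
    have "openin (sot_contractions X N) V'"
    proof (cases "m = 0")
      case False
      then show ?thesis
        unfolding V'_def using W by (intro openin_Int openin_topspace openin_INT) auto
    qed (simp add: V'_def)
    moreover have "T \<in> V'"
      using T U(1) r(1) by (auto simp: V'_def W_def topspace_sot contr_mem unit_mem)
    moreover have "V' \<subseteq> U"
    proof
      fix S
      assume S: "S \<in> V'"
      then have "sot_dist T S < r"
        using m by (auto simp: V'_def W_def)
      moreover have "S \<in> contr" "T \<in> contr"
        using S T U(1) by (auto simp: V'_def topspace_sot)
      ultimately show "S \<in> U"
        using r(2) by auto
    qed
    ultimately show "\<exists>V. openin (sot_contractions X N) V \<and> T \<in> V \<and> V \<subseteq> U"
      by blast
  qed
qed

text \<open>A Cauchy sequence converges pointwise since \<open>X\<close> is complete; linearity and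
  the norm bound pass to the limit. Convergence in \<open>sot_dist\<close> then involves only
  finitely many unit vectors for each radius.\<close>

lemma mcomplete_sot: "C.mcomplete"
  unfolding C.mcomplete_def
proof (intro allI impI)
  fix \<sigma>
  assume cauchy: "C.MCauchy \<sigma>"
  then have \<sigma>: "\<sigma> k \<in> contr" for k
    by (auto simp: C.MCauchy_def)
  have "\<exists>y. y \<in> X \<and> (\<lambda>k. D (\<sigma> k x) y) \<longlonglongrightarrow> 0" if x: "x \<in> X" for x
  proof -
    have "\<exists>M. \<forall>m\<ge>M. \<forall>n\<ge>M. D (\<sigma> m x) (\<sigma> n x) < \<epsilon>" if "\<epsilon> > 0" for \<epsilon>
    proof -
      obtain r where r: "r > 0"
        "\<forall>T\<in>contr. \<forall>S\<in>contr. sot_dist T S < r \<longrightarrow> D (T x) (S x) < \<epsilon>"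
        using sot_dist_eval[OF x \<open>\<epsilon> > 0\<close>] by blast
      then show ?thesis
        using cauchy \<sigma> unfolding C.MCauchy_def by meson
    qed
    then show ?thesis
      using D_complete[of "\<lambda>k. \<sigma> k x"] \<sigma> x contr_mem by metis
  qed
  then obtain L where L: "\<And>x. x \<in> X \<Longrightarrow> L x \<in> X" "\<And>x. x \<in> X \<Longrightarrow> (\<lambda>k. D (\<sigma> k x) (L x)) \<longlonglongrightarrow> 0"
    by metis
  \<comment> \<open>The pointwise limits are fixed only on \<open>X\<close>; the restriction makes
    the limit operator extensional, as membership in \<open>contr\<close> demands.\<close>
  define T where "T = restrict L X"
  have T_lim: "(\<lambda>k. D (\<sigma> k x) (T x)) \<longlonglongrightarrow> 0" if "x \<in> X" for x
    using L(2)[OF that] that by (simp add: T_def)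
  have T_mem: "T x \<in> X" if "x \<in> X" for x
    using L(1)[OF that] that by (simp add: T_def)
  have T: "T \<in> contr"
  proof (rule contractionI)
    show "T \<in> X \<rightarrow>\<^sub>E X"
      using L(1) by (simp add: T_def)
    show "T (\<lambda>n. x n + y n) = (\<lambda>n. T x n + T y n)" if x: "x \<in> X" and y: "y \<in> X" for x y
    proof (rule D_limit_unique)
      show "(\<lambda>k. D (\<sigma> k (\<lambda>n. x n + y n)) (T (\<lambda>n. x n + y n))) \<longlonglongrightarrow> 0"
        by (intro T_lim add_mem x y)
      show "(\<lambda>k. D (\<sigma> k (\<lambda>n. x n + y n)) (\<lambda>n. T x n + T y n)) \<longlonglongrightarrow> 0"
      proof (rule tendsto_sandwich[where f = "\<lambda>_. 0"])
        show "(\<lambda>k. D (\<sigma> k x) (T x) + D (\<sigma> k y) (T y)) \<longlonglongrightarrow> 0"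
          using tendsto_add[OF T_lim[OF x] T_lim[OF y]] by simp
        show "\<forall>\<^sub>F k in sequentially. D (\<sigma> k (\<lambda>n. x n + y n)) (\<lambda>n. T x n + T y n) \<le> D (\<sigma> k x) (T x) + D (\<sigma> k y) (T y)"
          using contr_add[OF \<sigma> x y] by (intro always_eventually allI) (simp add: D_add_le contr_mem[OF \<sigma>] T_mem x y)
      qed auto
    qed (auto intro: contr_mem[OF \<sigma>] T_mem add_mem x y)
    show "T (\<lambda>n. c * x n) = (\<lambda>n. c * T x n)" if x: "x \<in> X" for c x
    proof (rule D_limit_unique)
      show "(\<lambda>k. D (\<sigma> k (\<lambda>n. c * x n)) (T (\<lambda>n. c * x n))) \<longlonglongrightarrow> 0"
        by (intro T_lim scale_mem x)
      show "(\<lambda>k. D (\<sigma> k (\<lambda>n. c * x n)) (\<lambda>n. c * T x n)) \<longlonglongrightarrow> 0"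
        using tendsto_mult_left[OF T_lim[OF x], of "norm c"] contr_scale[OF \<sigma> x]
        by (simp add: D_scale contr_mem[OF \<sigma>] T_mem x)
    qed (auto intro: contr_mem[OF \<sigma>] T_mem scale_mem x)
    show "N (T x) \<le> N x" if x: "x \<in> X" for x
    proof (rule LIMSEQ_le_const)
      show "(\<lambda>k. D (\<sigma> k x) (T x) + N x) \<longlonglongrightarrow> N x"
        using tendsto_add[OF T_lim[OF x] tendsto_const[of "N x"]] by simp
      have "N (T x) \<le> D (\<sigma> k x) (T x) + N x" for k
        using V.triangle''[OF T_mem[OF x] contr_mem[OF \<sigma> x, of k] zero_mem] contr_norm[OF \<sigma> x, of k]
        by (simp add: D_zero T_mem contr_mem[OF \<sigma>] x)
      then show "\<exists>M. \<forall>k\<ge>M. N (T x) \<le> D (\<sigma> k x) (T x) + N x"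
        by blast
    qed
  qed
  have "\<forall>\<^sub>F k in sequentially. sot_dist (\<sigma> k) T < r" if "r > 0" for r
  proof -
    obtain m where m: "\<forall>T S. (\<forall>j<m. D (T (unit_seq j)) (S (unit_seq j)) < r / 2) \<longrightarrow> sot_dist T S < r"
      using sot_dist_lessI[OF \<open>r > 0\<close>] by blast
    have "\<forall>\<^sub>F k in sequentially. \<forall>j\<in>{..<m}. D (\<sigma> k (unit_seq j)) (T (unit_seq j)) < r / 2"
      using order_tendstoD(2)[OF T_lim[OF unit_mem], of "r / 2"] \<open>r > 0\<close>
      by (intro eventually_ball_finite) auto
    then show ?thesis
      by eventually_elim (use m in auto)
  qed
  then have "limitin C.mtopology \<sigma> T sequentially"
    using T \<sigma> by (simp add: C.limitin_metric)
  then show "\<exists>T. limitin C.mtopology \<sigma> T sequentially"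
    by blast
qed

text \<open>This is the Baire category theorem for the complete metric \<open>sot_dist\<close>, with
  density phrased by approximation.\<close>

lemma typical_contractionI:
  assumes "countable \<G>"
    and opn: "\<And>G. G \<in> \<G> \<Longrightarrow> openin (sot_contractions X N) G"
    and dense: "\<And>G T r. \<lbrakk>G \<in> \<G>; T \<in> contr; r > 0\<rbrakk> \<Longrightarrow> \<exists>S\<in>G. sot_dist T S < r"
    and P: "\<And>T. \<lbrakk>T \<in> contr; \<And>G. G \<in> \<G> \<Longrightarrow> T \<in> G\<rbrakk> \<Longrightarrow> P T"
  shows "typical_contraction X N P"
proof -
  \<comment> \<open>Adding \<open>contr\<close> keeps the family nonempty and the intersection
    inside the space, even when \<open>\<G>\<close> is empty.\<close>
  define H where "H = \<Inter>(insert contr \<G>)"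
  have *: "openin C.mtopology G \<and> C.mtopology closure_of G = contr" if "G \<in> insert contr \<G>" for G
  proof (cases "G \<in> \<G>")
    case True
    then have G: "openin C.mtopology G"
      using opn sot_contractions_eq by simp
    moreover have "G \<subseteq> contr"
      using openin_subset[OF G] by simp
    then have "C.mtopology closure_of G = contr"
      using dense[OF True] by (fastforce simp: C.metric_closure_of)
    ultimately show ?thesis
      by simp
  next
    case False
    then have "G = topspace C.mtopology"
      using that by simp
    then show ?thesis
      using closure_of_topspace[of C.mtopology] openin_topspace[of C.mtopology] by simp
  qed
  have "C.mtopology closure_of H = contr"
    unfolding H_def using \<open>countable \<G>\<close> * by (intro C.metric_Baire_category mcomplete_sot) auto
  moreover have "gdelta_in C.mtopology H"
    unfolding H_def using \<open>countable \<G>\<close> * by (intro gdelta_in_Inter open_imp_gdelta_in) auto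
  moreover have "H \<subseteq> {T \<in> contr. P T}"
    using P by (auto simp: H_def)
  ultimately show ?thesis
    unfolding typical_contraction_def comeager_in_def sot_contractions_eq by auto
qed

text \<open>Composition is continuous here because the operators are nonexpansive: compare
  \<open>T (T ^^ k) x\<close> with \<open>S (S ^^ k) x\<close> through \<open>S (T ^^ k) x\<close>.
  The first change is an evaluation at a fixed vector, the second is no larger than the change of
  the \<open>k\<close>-th iterates.\<close>

lemma continuous_map_sot_funpow:
  assumes x: "x \<in> X"
  shows "continuous_map (sot_contractions X N) V.mtopology (\<lambda>T. (T ^^ k) x)"
  unfolding sot_contractions_eq C.metric_continuous_map[OF V.Metric_space_axioms]
proof (intro conjI ballI)
  show "(\<lambda>T. (T ^^ k) x) ` contr \<subseteq> X"
    using funpow_mem x by auto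
  fix T
  assume T: "T \<in> contr"
  show "\<forall>\<epsilon>>0. \<exists>\<delta>>0. \<forall>S. S \<in> contr \<and> sot_dist T S < \<delta> \<longrightarrow> D ((T ^^ k) x) ((S ^^ k) x) < \<epsilon>"
  proof (induction k)
    case 0
    then show ?case
      using x by (auto intro: exI[of _ 1])
  next
    case (Suc k)
    show ?case
    proof (intro allI impI)
      fix \<epsilon> :: real
      assume "\<epsilon> > 0"
      let ?y = "(T ^^ k) x"
      have y: "?y \<in> X"
        by (rule funpow_mem[OF T x])
      obtain r1 where r1: "r1 > 0" "\<And>S. \<lbrakk>S \<in> contr; sot_dist T S < r1\<rbrakk> \<Longrightarrow> D ?y ((S ^^ k) x) < \<epsilon> / 2"
        using Suc[rule_format, OF half_gt_zero[OF \<open>\<epsilon> > 0\<close>]] by blast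
      obtain r2 where r2: "r2 > 0" "\<forall>T\<in>contr. \<forall>S\<in>contr. sot_dist T S < r2 \<longrightarrow> D (T ?y) (S ?y) < \<epsilon> / 2"
        using sot_dist_eval[OF y half_gt_zero[OF \<open>\<epsilon> > 0\<close>]] by blast
      have "D ((T ^^ Suc k) x) ((S ^^ Suc k) x) < \<epsilon>" if S: "S \<in> contr" and "sot_dist T S < min r1 r2" for S
      proof -
        have "D (T ?y) (S ((S ^^ k) x)) \<le> D (T ?y) (S ?y) + D (S ?y) (S ((S ^^ k) x))"
          by (rule V.triangle[OF contr_mem[OF T y] contr_mem[OF S y] contr_mem[OF S funpow_mem[OF S x]]])
        also have "D (S ?y) (S ((S ^^ k) x)) \<le> D ?y ((S ^^ k) x)"
          by (rule contr_D[OF S y funpow_mem[OF S x]])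
        also have "D (T ?y) (S ?y) + D ?y ((S ^^ k) x) < \<epsilon>"
          using add_strict_mono[OF r2(2)[rule_format, OF T S] r1(2)[OF S]] that(2) by simp
        finally show ?thesis
          by simp
      qed
      then show "\<exists>\<delta>>0. \<forall>S. S \<in> contr \<and> sot_dist T S < \<delta> \<longrightarrow> D ((T ^^ Suc k) x) ((S ^^ Suc k) x) < \<epsilon>"
        using r1(1) r2(1) by (intro exI[of _ "min r1 r2"]) auto
    qed
  qed
qed

lemma openin_sot_funpow:
  assumes "x \<in> X" "z \<in> X"
  shows "openin (sot_contractions X N) {T \<in> contr. D ((T ^^ k) x) z < c}"
proof -
  have "{T \<in> contr. D ((T ^^ k) x) z < c} =
      {T \<in> topspace (sot_contractions X N). (T ^^ k) x \<in> V.mball z c}"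
    using assms by (auto simp: topspace_sot funpow_mem V.commute)
  then show ?thesis
    using openin_continuous_map_preimage[OF continuous_map_sot_funpow[OF assms(1)] V.openin_mball]
    by simp
qed

end

section \<open>Dense range and spectrum\<close>

context sequence_space
begin

lemma norm_unit_pos: "0 < N (unit_seq j)"
proof -
  have "N (unit_seq j) \<noteq> 0"
    using norm_eq_0[OF unit_mem, of j] by (metis unit_seq_def zero_neq_one)
  then show ?thesis
    using norm_nonneg[OF unit_mem, of j] by simp
qed

lemma norm_sub: "\<lbrakk>x \<in> X; y \<in> X\<rbrakk> \<Longrightarrow> N x \<le> N y + D x y"
  using V.triangle[of x y "\<lambda>_. 0"] by (simp add: D_zero zero_mem)

section \<open>Range and lower bounds of \<open>T - \<mu>\<close>\<close>

context
  fixes T and \<mu> :: complex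
  assumes T: "T \<in> contr"
begin

abbreviation shifted :: "(nat \<Rightarrow> complex) \<Rightarrow> nat \<Rightarrow> complex" where
  "shifted \<equiv> minus_scalar X T \<mu>"

lemma shifted_eq: "x \<in> X \<Longrightarrow> shifted x = (\<lambda>n. T x n - \<mu> * x n)"
  by (simp add: minus_scalar_def)

lemma shifted_mem: "x \<in> X \<Longrightarrow> shifted x \<in> X"
  by (simp add: shifted_eq diff_mem scale_mem contr_mem[OF T])

lemma shifted_add: "\<lbrakk>x \<in> X; y \<in> X\<rbrakk> \<Longrightarrow> shifted (\<lambda>n. x n + y n) = (\<lambda>n. shifted x n + shifted y n)"
  by (auto simp: shifted_eq add_mem contr_add[OF T] algebra_simps)

lemma shifted_scale: "x \<in> X \<Longrightarrow> shifted (\<lambda>n. c * x n) = (\<lambda>n. c * shifted x n)"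
  by (auto simp: shifted_eq scale_mem contr_scale[OF T] algebra_simps)

lemma shifted_diff: "\<lbrakk>x \<in> X; y \<in> X\<rbrakk> \<Longrightarrow> shifted (\<lambda>n. x n - y n) = (\<lambda>n. shifted x n - shifted y n)"
  using shifted_add[OF _ scale_mem[of y "-1"]] shifted_scale[of y "-1"] by simp

lemma shifted_norm:
  assumes "x \<in> X"
  shows "N (shifted x) \<le> (1 + norm \<mu>) * N x"
proof -
  have "N (shifted x) \<le> N (T x) + D (shifted x) (T x)"
    by (rule norm_sub[OF shifted_mem[OF assms] contr_mem[OF T assms]])
  also have "D (shifted x) (T x) = norm (-\<mu>) * N x"
    unfolding norm_scale[OF assms, symmetric]
    by (simp add: D_eq shifted_mem assms contr_mem[OF T]) (simp add: shifted_eq assms)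
  finally show ?thesis
    using contr_norm[OF T assms] by (simp add: algebra_simps)
qed

text \<open>\<open>T - \<mu>\<close> is a factor of \<open>T^k - \<mu>^k\<close>. The recursion is
  \<open>T^(k+1) u - \<mu>^(k+1) u = (T - \<mu>) (T^k u) + \<mu> (T^k u - \<mu>^k
  u)\<close>.\<close>

lemma funpow_minus_power_in_range:
  assumes u: "u \<in> X"
  shows "\<exists>w\<in>X. (\<lambda>n. (T ^^ k) u n - \<mu> ^ k * u n) = shifted w"
proof (induction k)
  case 0
  have "shifted (\<lambda>_. 0) = (\<lambda>_. 0)"
    by (simp add: shifted_eq zero_mem contr_zero[OF T])
  then show ?case
    by (intro bexI[OF _ zero_mem]) simp
next
  case (Suc k)
  then obtain w where w: "w \<in> X" "(\<lambda>n. (T ^^ k) u n - \<mu> ^ k * u n) = shifted w"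
    by blast
  let ?z = "(T ^^ k) u"
  have z: "?z \<in> X"
    by (rule funpow_mem[OF T u])
  have "shifted (\<lambda>n. ?z n + \<mu> * w n) = (\<lambda>n. shifted ?z n + \<mu> * shifted w n)"
    by (simp add: shifted_add shifted_scale z w(1) scale_mem)
  also have "\<dots> = (\<lambda>n. (T ^^ Suc k) u n - \<mu> ^ Suc k * u n)"
    by (simp add: shifted_eq z w(2)[symmetric] algebra_simps)
  finally show ?case
    by (intro bexI[OF _ add_mem[OF z scale_mem[OF w(1)]]]) (rule sym)
qed

text \<open>The closure of the range is a closed subspace; once it contains the unit vectors it
  contains all heads and, by \<open>norm_tail\<close>, everything.\<close>

lemma dense_range_shiftedI:
  assumes unit: "\<And>j \<epsilon>. \<epsilon> > 0 \<Longrightarrow> \<exists>x\<in>X. D (shifted x) (unit_seq j) < \<epsilon>"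
  shows "dense_range X N shifted"
proof -
  let ?P = "\<lambda>y. \<forall>\<epsilon>>0. \<exists>x\<in>X. D (shifted x) y < \<epsilon>"
  have add: "?P (\<lambda>i. y i + c * z i)" if "?P y" "?P z" and yz: "y \<in> X" "z \<in> X" for y z c
  proof (intro allI impI)
    fix \<epsilon> :: real
    assume "\<epsilon> > 0"
    \<comment> \<open>The denominator uses \<open>norm c + 1\<close> so that \<open>c = 0\<close>
      needs no separate case.\<close>
    then have "\<epsilon> / 2 > 0" "\<epsilon> / (2 * (norm c + 1)) > 0"
      by (auto simp: add_nonneg_pos intro!: divide_pos_pos)
    then obtain v w where v: "v \<in> X" "D (shifted v) y < \<epsilon> / 2"
      and w: "w \<in> X" "D (shifted w) z < \<epsilon> / (2 * (norm c + 1))"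
      using \<open>?P y\<close> \<open>?P z\<close> by blast
    let ?x = "\<lambda>i. v i + c * w i"
    have x: "?x \<in> X"
      by (intro add_mem scale_mem v w)
    have "shifted ?x = (\<lambda>i. shifted v i + c * shifted w i)"
      by (simp add: shifted_add shifted_scale scale_mem v w)
    then have "D (shifted ?x) (\<lambda>i. y i + c * z i) \<le> D (shifted v) y + norm c * D (shifted w) z"
      using D_add_le[OF shifted_mem[OF v(1)] scale_mem[OF shifted_mem[OF w(1)], of c] yz(1) scale_mem[OF yz(2), of c]]
      by (simp add: D_scale shifted_mem w(1) yz(2))
    also have "norm c * D (shifted w) z \<le> norm c * (\<epsilon> / (2 * (norm c + 1)))"
      using w(2) by (intro mult_left_mono) auto
    also have "\<dots> \<le> \<epsilon> / 2"
    proof -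
      have "K * (\<epsilon> / (2 * (K + 1))) \<le> \<epsilon> / 2" if "K \<ge> 0" for K
        using that \<open>\<epsilon> > 0\<close> by (simp add: field_simps)
      then show ?thesis
        by simp
    qed
    finally have "D (shifted ?x) (\<lambda>i. y i + c * z i) < \<epsilon>"
      using v(2) by simp
    then show "\<exists>x\<in>X. D (shifted x) (\<lambda>i. y i + c * z i) < \<epsilon>"
      using x by blast
  qed
  \<comment> \<open>A head grows by one multiple of a unit vector at a time, so \<open>add\<close>
    applies at each step.\<close>
  have head: "?P (head n y)" if y: "y \<in> X" for n y
  proof (induction n)
    case 0
    have "shifted (\<lambda>_. 0) = head 0 y"
      by (auto simp: shifted_eq zero_mem contr_zero[OF T] head_def)
    then show ?case
      using zero_mem head_mem[OF y, of 0] by (metis V.mdist_zero)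
  next
    case (Suc n)
    then show ?case
      unfolding head_Suc using unit by (intro add head_mem y unit_mem) blast+
  qed
  have "\<exists>x\<in>X. D (shifted x) y < \<epsilon>" if y: "y \<in> X" and "\<epsilon> > 0" for y \<epsilon>
  proof -
    have "\<forall>\<^sub>F n in sequentially. D y (head n y) < \<epsilon> / 2"
      using order_tendstoD(2)[OF D_head_tendsto[OF y], of "\<epsilon> / 2"] \<open>\<epsilon> > 0\<close> by simp
    then obtain n where n: "D y (head n y) < \<epsilon> / 2"
      by (auto simp: eventually_sequentially)
    obtain x where x: "x \<in> X" "D (shifted x) (head n y) < \<epsilon> / 2"
      using head[OF y, of n] half_gt_zero[OF \<open>\<epsilon> > 0\<close>] by blast
    have "D (shifted x) y < \<epsilon>"
      using V.triangle'[OF shifted_mem[OF x(1)] head_mem[OF y, of n] y] x(2) n by simp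
    then show ?thesis
      using x(1) by blast
  qed
  then have "\<exists>z\<in>shifted ` X. z \<in> V.mball y \<epsilon>" if "y \<in> X" "\<epsilon> > 0" for y \<epsilon>
    using that shifted_mem by (auto simp: V.commute)
  then show ?thesis
    unfolding dense_range_def norm_topology_def V.metric_closure_of by blast
qed

text \<open>With \<open>u = - e / \<mu>^k\<close> the range contains
  \<open>e - T^k e / \<mu>^k\<close>, and the factor \<open>1 / \<mu>^k\<close> does not enlarge the
  error because the modulus of \<open>\<mu>\<close> is at least 1.\<close>

lemma dense_range_ge_1:
  assumes "norm \<mu> \<ge> 1"
    and small: "\<And>j \<epsilon>. \<epsilon> > 0 \<Longrightarrow> \<exists>k. N ((T ^^ k) (unit_seq j)) < \<epsilon>"
  shows "dense_range X N shifted"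
proof (rule dense_range_shiftedI)
  fix j and \<epsilon> :: real
  assume "\<epsilon> > 0"
  then obtain k where k: "N ((T ^^ k) (unit_seq j)) < \<epsilon>"
    using small by blast
  have "\<mu> \<noteq> 0"
    using assms(1) by auto
  let ?c = "- (1 / \<mu> ^ k)"
  have Te: "(T ^^ k) (unit_seq j) \<in> X"
    by (rule funpow_mem[OF T unit_mem])
  obtain w where w: "w \<in> X"
    "(\<lambda>n. (T ^^ k) (\<lambda>n. ?c * unit_seq j n) n - \<mu> ^ k * (?c * unit_seq j n)) = shifted w"
    using funpow_minus_power_in_range[OF scale_mem[OF unit_mem]] by blast
  have "(\<lambda>n. (T ^^ k) (\<lambda>n. ?c * unit_seq j n) n - \<mu> ^ k * (?c * unit_seq j n))
      = (\<lambda>n. ?c * (T ^^ k) (unit_seq j) n + unit_seq j n)"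
    unfolding funpow_scale[OF T unit_mem] using \<open>\<mu> \<noteq> 0\<close> by auto
  then have "shifted w = (\<lambda>n. ?c * (T ^^ k) (unit_seq j) n + unit_seq j n)"
    using w(2) by simp
  then have "D (shifted w) (unit_seq j) = N (\<lambda>n. ?c * (T ^^ k) (unit_seq j) n)"
    unfolding D_eq[OF shifted_mem[OF w(1)] unit_mem] by simp
  also have "\<dots> = norm ?c * N ((T ^^ k) (unit_seq j))"
    by (rule norm_scale[OF Te])
  also have "\<dots> \<le> 1 * N ((T ^^ k) (unit_seq j))"
    using norm_nonneg[OF Te] assms(1) \<open>\<mu> \<noteq> 0\<close>
    by (intro mult_right_mono) (simp_all add: norm_divide norm_power one_le_power divide_le_eq_1)
  finally show "\<exists>x\<in>X. D (shifted x) (unit_seq j) < \<epsilon>"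
    using k w(1) by (intro bexI[of _ w]) auto
qed

text \<open>The range vector \<open>T^k u - \<mu>^k u\<close> is close to the unit vector: the first
  term by choice of \<open>u\<close>, and the second has norm at most
  \<open>s ^ k * N u\<close>.\<close>

lemma dense_range_less_1:
  assumes "norm \<mu> \<le> s"
    and preimage: "\<And>j \<epsilon>. \<epsilon> > 0 \<Longrightarrow> \<exists>k. \<exists>u\<in>X. D ((T ^^ k) u) (unit_seq j) < \<epsilon> \<and> s ^ k * N u < \<epsilon>"
  shows "dense_range X N shifted"
proof (rule dense_range_shiftedI)
  fix j and \<epsilon> :: real
  assume "\<epsilon> > 0"
  then obtain k u where u: "u \<in> X" "D ((T ^^ k) u) (unit_seq j) < \<epsilon> / 2" "s ^ k * N u < \<epsilon> / 2"
    using preimage half_gt_zero by blast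
  obtain w where w: "w \<in> X" "(\<lambda>n. (T ^^ k) u n - \<mu> ^ k * u n) = shifted w"
    using funpow_minus_power_in_range[OF u(1)] by blast
  have Tu: "(T ^^ k) u \<in> X"
    by (rule funpow_mem[OF T u(1)])
  have "D (shifted w) (unit_seq j) \<le> D ((T ^^ k) u) (shifted w) + D ((T ^^ k) u) (unit_seq j)"
    by (rule V.triangle''[OF shifted_mem[OF w(1)] Tu unit_mem])
  also have "D ((T ^^ k) u) (shifted w) = N (\<lambda>n. \<mu> ^ k * u n)"
    by (simp add: D_eq shifted_mem w(1) Tu) (simp add: w(2)[symmetric])
  also have "\<dots> = norm \<mu> ^ k * N u"
    by (simp add: norm_scale u(1) norm_power)
  also have "\<dots> \<le> s ^ k * N u"
    using assms(1) by (intro mult_right_mono power_mono norm_nonneg u(1)) auto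
  finally show "\<exists>x\<in>X. D (shifted x) (unit_seq j) < \<epsilon>"
    using u(2,3) w(1) by (intro bexI[of _ w]) auto
qed

lemma bounded_below_shifted:
  assumes "norm \<mu> > 1"
  shows "bounded_below X N shifted"
  unfolding bounded_below_def
\<comment> \<open>The constant comes from the triangle inequality: \<open>T\<close> can cancel at
  most \<open>N x\<close> out of \<open>norm \<mu> * N x\<close>.\<close>
proof (intro exI[of _ "norm \<mu> - 1"] conjI ballI)
  fix x
  assume x: "x \<in> X"
  have "norm \<mu> * N x = N (\<lambda>n. \<mu> * x n)"
    by (simp add: norm_scale x)
  also have "\<dots> \<le> N (T x) + D (\<lambda>n. \<mu> * x n) (T x)"
    by (intro norm_sub scale_mem x contr_mem[OF T x])
  also have "D (\<lambda>n. \<mu> * x n) (T x) = N (shifted x)"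
    by (subst V.commute) (simp add: D_eq scale_mem x contr_mem[OF T] shifted_eq)
  finally show "(norm \<mu> - 1) * N x \<le> N (shifted x)"
    using contr_norm[OF T x] by (simp add: algebra_simps)
qed (use assms in simp)

lemma bounded_below_if_invertible:
  assumes "invertible_operator X N shifted"
  shows "bounded_below X N shifted"
proof -
  obtain B C where B: "\<And>x. x \<in> X \<Longrightarrow> B (shifted x) = x" and C: "\<And>x. x \<in> X \<Longrightarrow> N (B x) \<le> C * N x"
    using assms unfolding invertible_operator_def bounded_operators_def by blast
  show ?thesis
    unfolding bounded_below_def
  \<comment> \<open>Enlarging \<open>C\<close> to \<open>\<bar>C\<bar> + 1\<close> gives a positive
    denominator without a case distinction.\<close>
  proof (intro exI[of _ "1 / (\<bar>C\<bar> + 1)"] conjI ballI)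
    fix x
    assume x: "x \<in> X"
    have "N x \<le> C * N (shifted x)"
      using B[OF x] C[OF shifted_mem[OF x]] by simp
    also have "\<dots> \<le> (\<bar>C\<bar> + 1) * N (shifted x)"
      by (intro mult_right_mono norm_nonneg shifted_mem x) simp
    finally show "1 / (\<bar>C\<bar> + 1) * N x \<le> N (shifted x)"
      by (simp add: field_simps add_pos_nonneg)
  qed simp
qed

text \<open>A lower bound makes the operator injective and its range closed: preimages of a
  convergent sequence are Cauchy, so by completeness their limit maps to the given point. A dense
  closed range is everything, and the inverse is bounded by \<open>1 / c\<close>.\<close>

lemma invertible_if_bounded_below_dense_range:
  assumes "bounded_below X N shifted" and "dense_range X N shifted"
  shows "invertible_operator X N shifted"
proof -
  obtain c where c: "c > 0" "\<And>x. x \<in> X \<Longrightarrow> c * N x \<le> N (shifted x)"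
    using assms(1) by (auto simp: bounded_below_def)
  have D_le: "c * D x y \<le> D (shifted x) (shifted y)" if "x \<in> X" "y \<in> X" for x y
    using c(2)[OF diff_mem[OF that]] by (simp add: D_eq that shifted_mem shifted_diff)
  have D_ge: "D (shifted x) (shifted y) \<le> (1 + norm \<mu>) * D x y" if "x \<in> X" "y \<in> X" for x y
    using shifted_norm[OF diff_mem[OF that]] by (simp add: D_eq that shifted_mem shifted_diff)
  have inj: "inj_on shifted X"
  proof (rule inj_onI)
    fix x y
    assume xy: "x \<in> X" "y \<in> X" "shifted x = shifted y"
    then have "c * D x y \<le> 0"
      using D_le[of x y] shifted_mem by simp
    then have "D x y = 0"
      using c(1) V.nonneg[of x y] by (simp add: mult_le_0_iff order_antisym)
    then show "x = y"
      using xy by simp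
  qed
  have surj: "y \<in> shifted ` X" if y: "y \<in> X" for y
  proof -
    have "y \<in> V.mtopology closure_of (shifted ` X)"
      using assms(2) y by (simp add: dense_range_def norm_topology_def)
    then have "\<exists>x\<in>X. D (shifted x) y < \<epsilon>" if "\<epsilon> > 0" for \<epsilon>
      using that by (fastforce simp: V.metric_closure_of V.commute)
    then have "\<exists>x. x \<in> X \<and> D (shifted x) y < inverse (real (Suc k))" for k
      by (meson inverse_positive_iff_positive of_nat_0_less_iff zero_less_Suc)
    then obtain \<sigma> where \<sigma>: "\<And>k. \<sigma> k \<in> X" "\<And>k. D (shifted (\<sigma> k)) y < inverse (real (Suc k))"
      by metis
    have image_lim: "(\<lambda>k. D (shifted (\<sigma> k)) y) \<longlonglongrightarrow> 0"
      by (rule tendsto_sandwich[where f = "\<lambda>_. 0", OF _ _ tendsto_const LIMSEQ_inverse_real_of_nat])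
         (use \<sigma>(2) in \<open>auto intro!: always_eventually less_imp_le\<close>)
    have "\<exists>M. \<forall>m\<ge>M. \<forall>n\<ge>M. D (\<sigma> m) (\<sigma> n) < \<epsilon>" if "\<epsilon> > 0" for \<epsilon>
    proof -
      have "c * \<epsilon> / 2 > 0"
        using c(1) \<open>\<epsilon> > 0\<close> by simp
      then have "\<forall>\<^sub>F k in sequentially. D (shifted (\<sigma> k)) y < c * \<epsilon> / 2"
        using order_tendstoD(2)[OF image_lim] by blast
      then obtain M where M: "\<And>k. k \<ge> M \<Longrightarrow> D (shifted (\<sigma> k)) y < c * \<epsilon> / 2"
        by (auto simp: eventually_sequentially)
      have "D (\<sigma> m) (\<sigma> n) < \<epsilon>" if "m \<ge> M" "n \<ge> M" for m n
      proof -
        have "c * D (\<sigma> m) (\<sigma> n) \<le> D (shifted (\<sigma> m)) (shifted (\<sigma> n))"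
          by (rule D_le[OF \<sigma>(1) \<sigma>(1)])
        also have "\<dots> \<le> D (shifted (\<sigma> m)) y + D (shifted (\<sigma> n)) y"
          by (rule V.triangle'[OF shifted_mem[OF \<sigma>(1)] y shifted_mem[OF \<sigma>(1)]])
        also have "\<dots> < c * \<epsilon>"
          using M[OF that(1)] M[OF that(2)] by simp
        finally show ?thesis
          using c(1) by simp
      qed
      then show ?thesis
        by blast
    qed
    then obtain x where x: "x \<in> X" "(\<lambda>k. D (\<sigma> k) x) \<longlonglongrightarrow> 0"
      using D_complete[of \<sigma>, OF \<sigma>(1)] by blast
    have "(\<lambda>k. D (shifted (\<sigma> k)) (shifted x)) \<longlonglongrightarrow> 0"
    proof (rule tendsto_sandwich[where f = "\<lambda>_. 0"])
      show "(\<lambda>k. (1 + norm \<mu>) * D (\<sigma> k) x) \<longlonglongrightarrow> 0"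
        using tendsto_mult_left[OF x(2), of "1 + norm \<mu>"] by simp
    qed (use D_ge[OF \<sigma>(1) x(1)] in auto)
    then have "shifted x = y"
      by (rule D_limit_unique) (use image_lim \<sigma>(1) x(1) y shifted_mem in auto)
    then show ?thesis
      using x(1) by blast
  qed
  define B where "B = restrict (inv_into X shifted) X"
  have B_mem: "B y \<in> X" and shifted_B: "shifted (B y) = y" if "y \<in> X" for y
    using surj[OF that] that by (auto simp: B_def inv_into_into f_inv_into_f)
  have B_shifted: "B (shifted x) = x" if "x \<in> X" for x
    using that inj by (simp add: B_def shifted_mem)
  have "B \<in> bounded_operators X N"
    unfolding bounded_operators_def mem_Collect_eq
  proof (intro conjI ballI allI)
    show "B \<in> X \<rightarrow>\<^sub>E X"
      using B_mem by (auto simp: B_def)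
    show "B (\<lambda>n. x n + y n) = (\<lambda>n. B x n + B y n)" if "x \<in> X" "y \<in> X" for x y
    proof -
      have "shifted (\<lambda>n. B x n + B y n) = (\<lambda>n. x n + y n)"
        by (simp add: shifted_add B_mem shifted_B that)
      then show ?thesis
        by (metis B_shifted add_mem B_mem that)
    qed
    show "B (\<lambda>n. a * x n) = (\<lambda>n. a * B x n)" if "x \<in> X" for a x
    proof -
      have "shifted (\<lambda>n. a * B x n) = (\<lambda>n. a * x n)"
        by (simp add: shifted_scale B_mem shifted_B that)
      then show ?thesis
        by (metis B_shifted scale_mem B_mem that)
    qed
    show "\<exists>C. \<forall>x\<in>X. N (B x) \<le> C * N x"
      using c(1) c(2)[OF B_mem] shifted_B by (intro exI[of _ "1 / c"]) (auto simp: field_simps)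
  qed
  then show ?thesis
    using B_shifted shifted_B by (auto simp: invertible_operator_def)
qed

end

text \<open>The approximate point spectrum is closed. A lower bound \<open>c\<close> at
  \<open>\<mu>\<close> would leave a lower bound \<open>c / 2\<close> at every \<open>\<nu>\<close>
  within \<open>c / 2\<close>, against the approximate eigenvectors for \<open>\<nu>\<close>. The
  strict inequality in the hypothesis already excludes \<open>x = 0\<close>.\<close>

lemma not_bounded_below_closure:
  assumes T: "T \<in> contr" and \<mu>: "\<mu> \<in> closure Q"
    and Q: "\<And>\<nu> \<epsilon>. \<lbrakk>\<nu> \<in> Q; \<epsilon> > 0\<rbrakk> \<Longrightarrow> \<exists>x\<in>X. D (T x) (\<lambda>n. \<nu> * x n) < \<epsilon> * N x"
  shows "\<not> bounded_below X N (minus_scalar X T \<mu>)"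
proof
  assume "bounded_below X N (minus_scalar X T \<mu>)"
  then obtain c where c: "c > 0" "\<And>x. x \<in> X \<Longrightarrow> c * N x \<le> N (minus_scalar X T \<mu> x)"
    by (auto simp: bounded_below_def)
  obtain \<nu> where \<nu>: "\<nu> \<in> Q" "dist \<nu> \<mu> < c / 2"
    using \<mu> half_gt_zero[OF c(1)] closure_approachable by blast
  obtain x where x: "x \<in> X" "D (T x) (\<lambda>n. \<nu> * x n) < c / 2 * N x"
    using Q[OF \<nu>(1) half_gt_zero[OF c(1)]] by blast
  have "c * N x \<le> D (T x) (\<lambda>n. \<mu> * x n)"
    using c(2)[OF x(1)] by (simp add: shifted_eq[OF T x(1)] D_eq contr_mem[OF T x(1)] scale_mem x(1))
  also have "\<dots> \<le> D (T x) (\<lambda>n. \<nu> * x n) + D (\<lambda>n. \<nu> * x n) (\<lambda>n. \<mu> * x n)"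
    by (rule V.triangle[OF contr_mem[OF T x(1)] scale_mem[OF x(1)] scale_mem[OF x(1)]])
  also have "D (\<lambda>n. \<nu> * x n) (\<lambda>n. \<mu> * x n) = dist \<nu> \<mu> * N x"
    using norm_scale[OF x(1), of "\<nu> - \<mu>"] by (simp add: D_eq scale_mem x(1) dist_norm left_diff_distrib)
  also have "\<dots> \<le> c / 2 * N x"
    using \<nu>(2) by (intro mult_right_mono norm_nonneg x(1)) simp
  finally show False
    using x(2) by simp
qed

text \<open>Under dense range, invertibility and being bounded below coincide, so both spectra are
  the complement of the region where the modulus of \<open>\<mu>\<close> exceeds 1.\<close>

lemma spectrum_eq_cball:
  assumes T: "T \<in> contr"
    and dense: "\<And>\<mu>. dense_range X N (minus_scalar X T \<mu>)"
    and not_below: "\<And>\<mu>. norm \<mu> \<le> 1 \<Longrightarrow> \<not> bounded_below X N (minus_scalar X T \<mu>)"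
  shows "op_spectrum X N T = cball 0 1" and "approx_point_spectrum X N T = cball 0 1"
proof -
  have "bounded_below X N (minus_scalar X T \<mu>) \<longleftrightarrow> norm \<mu> > 1" for \<mu>
    using bounded_below_shifted[OF T] not_below by (meson not_le)
  moreover have "invertible_operator X N (minus_scalar X T \<mu>) \<longleftrightarrow> bounded_below X N (minus_scalar X T \<mu>)" for \<mu>
    using bounded_below_if_invertible[OF T] invertible_if_bounded_below_dense_range[OF T _ dense] by blast
  ultimately show "op_spectrum X N T = cball 0 1" "approx_point_spectrum X N T = cball 0 1"
    by (auto simp: op_spectrum_def approx_point_spectrum_def)
qed

end

section \<open>Approximating operators\<close>

lemma head_add: "head n (\<lambda>i. x i + y i) = (\<lambda>i. head n x i + head n y i)"
  and head_scale: "head n (\<lambda>i. c * x i) = (\<lambda>i. c * head n x i)"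
  and tail_add: "tail n (\<lambda>i. x i + y i) = (\<lambda>i. tail n x i + tail n y i)"
  and tail_scale: "tail n (\<lambda>i. c * x i) = (\<lambda>i. c * tail n x i)"
  and head_plus_tail: "(\<lambda>i. head n x i + tail n x i) = x"
  by (auto simp: head_def tail_def)

lemma head_unit_seq: "j < n \<Longrightarrow> head n (unit_seq j) = unit_seq j"
  and tail_unit_seq: "j < n \<Longrightarrow> tail n (unit_seq j) = (\<lambda>_. 0)"
  by (auto simp: head_def tail_def unit_seq_def)

context sequence_space
begin

text \<open>Closeness to \<open>T0\<close> prescribes only the images of the first \<open>n\<close>
  unit vectors. The action on the remaining ones stays free, and the two extensions below exploit
  this freedom.\<close>

lemma approximation_by_compressions:
  assumes T0: "T0 \<in> contr" and "r > 0"
  shows "\<exists>n \<delta>. 0 < n \<and> 0 < \<delta> \<and> \<delta> < 1 \<and>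
    (\<forall>T. (\<forall>j<n. T (unit_seq j) = (\<lambda>i. complex_of_real (1 - \<delta>) * head n (T0 (unit_seq j)) i))
      \<longrightarrow> sot_dist T0 T < r)"
proof -
  obtain m where m: "\<forall>T S. (\<forall>j<m. D (T (unit_seq j)) (S (unit_seq j)) < r / 2) \<longrightarrow> sot_dist T S < r"
    using sot_dist_lessI[OF \<open>r > 0\<close>] by blast
  define K where "K = (\<Sum>j<m. N (unit_seq j))"
  have K: "K \<ge> 0"
    by (simp add: K_def sum_nonneg norm_nonneg unit_mem)
  \<comment> \<open>Shrinking by \<open>1 - \<delta>\<close> moves each of the \<open>m\<close>
    relevant images by at most \<open>\<delta> * K\<close>, hence by at most \<open>r / 8\<close>;
    the bound \<open>1 / 2\<close> keeps \<open>\<delta>\<close> below 1.\<close>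
  define \<delta> where "\<delta> = min (1 / 2) (r / (8 * (K + 1)))"
  have \<delta>: "0 < \<delta>" "\<delta> < 1"
    using K \<open>r > 0\<close> by (auto simp: \<delta>_def)
  have \<delta>K: "\<delta> * K \<le> r / 8"
  proof -
    have "\<delta> * K \<le> r / (8 * (K + 1)) * K"
      using K by (intro mult_right_mono) (simp_all add: \<delta>_def)
    also have "\<dots> \<le> r / 8"
      using K \<open>r > 0\<close> by (simp add: field_simps)
    finally show ?thesis .
  qed
  have Tu: "T0 (unit_seq j) \<in> X" for j
    by (rule contr_mem[OF T0 unit_mem])
  have "\<forall>\<^sub>F n in sequentially. \<forall>j\<in>{..<m}. D (T0 (unit_seq j)) (head n (T0 (unit_seq j))) < r / 4"
    using order_tendstoD(2)[OF D_head_tendsto[OF Tu], of "r / 4"] \<open>r > 0\<close>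
    by (intro eventually_ball_finite) auto
  then obtain n0 where n0: "\<And>n j. \<lbrakk>n \<ge> n0; j < m\<rbrakk> \<Longrightarrow> D (T0 (unit_seq j)) (head n (T0 (unit_seq j))) < r / 4"
    by (auto simp: eventually_sequentially)
  \<comment> \<open>Beyond \<open>n0\<close> the truncation error is below \<open>r / 4\<close>;
    beyond \<open>m\<close> all relevant unit vectors have prescribed images; \<open>Suc\<close>
    makes \<open>n\<close> positive.\<close>
  define n where "n = Suc (max n0 m)"
  have "sot_dist T0 T < r"
    if T: "\<forall>j<n. T (unit_seq j) = (\<lambda>i. complex_of_real (1 - \<delta>) * head n (T0 (unit_seq j)) i)" for T
  proof (rule m[rule_format])
    fix j
    assume j: "j < m"
    let ?h = "head n (T0 (unit_seq j))"
    have h: "?h \<in> X"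
      by (rule head_mem[OF Tu])
    have "D ?h (T (unit_seq j)) = N (\<lambda>i. complex_of_real \<delta> * ?h i)"
      using j T D_eq[OF h scale_mem[OF h, of "complex_of_real (1 - \<delta>)"]]
      by (simp add: n_def algebra_simps)
    also have "\<dots> = \<delta> * N ?h"
      using \<delta> by (simp add: norm_scale h)
    also have "\<dots> \<le> \<delta> * K"
    proof (rule mult_left_mono)
      have "N ?h \<le> N (unit_seq j)"
        using norm_head_le[OF Tu, of n j] contr_norm[OF T0 unit_mem, of j] by simp
      also have "\<dots> \<le> K"
        unfolding K_def using j by (intro member_le_sum) (auto intro: norm_nonneg unit_mem)
      finally show "N ?h \<le> K" .
    qed (use \<delta> in simp)
    finally have "D ?h (T (unit_seq j)) \<le> r / 8"
      using \<delta>K by simp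
    moreover have "D (T0 (unit_seq j)) ?h < r / 4"
      using j by (intro n0) (auto simp: n_def)
    moreover have "T (unit_seq j) \<in> X"
      using j T scale_mem[OF h] by (simp add: n_def)
    then have "D (T0 (unit_seq j)) (T (unit_seq j)) \<le> D (T0 (unit_seq j)) ?h + D ?h (T (unit_seq j))"
      by (intro V.triangle Tu h)
    ultimately show "D (T0 (unit_seq j)) (T (unit_seq j)) < r / 2"
      using \<open>r > 0\<close> by linarith
  qed
  then show ?thesis
    using \<delta> by (intro exI[of _ n] exI[of _ \<delta>]) (auto simp: n_def)
qed

section \<open>Two contractive extensions of a compression\<close>

context
  fixes T0 and n :: nat and \<delta> :: real
  assumes T0: "T0 \<in> contr" and n: "0 < n" and \<delta>: "0 < \<delta>" "\<delta> < 1"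
begin

definition compression :: "(nat \<Rightarrow> complex) \<Rightarrow> nat \<Rightarrow> complex" where
  "compression x = (\<lambda>i. complex_of_real (1 - \<delta>) * head n (T0 (head n x)) i)"

lemma compression_mem: "x \<in> X \<Longrightarrow> compression x \<in> X"
  unfolding compression_def by (intro scale_mem head_mem contr_mem[OF T0])

lemma compression_add:
  "\<lbrakk>x \<in> X; y \<in> X\<rbrakk> \<Longrightarrow> compression (\<lambda>i. x i + y i) = (\<lambda>i. compression x i + compression y i)"
  by (auto simp: compression_def head_add contr_add[OF T0] head_mem algebra_simps)

lemma compression_scale: "x \<in> X \<Longrightarrow> compression (\<lambda>i. c * x i) = (\<lambda>i. c * compression x i)"
  by (auto simp: compression_def head_scale contr_scale[OF T0] head_mem algebra_simps)

lemma compression_norm: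
  assumes "x \<in> X"
  shows "N (compression x) \<le> (1 - \<delta>) * N (head n x)"
proof -
  have "N (compression x) = norm (complex_of_real (1 - \<delta>)) * N (head n (T0 (head n x)))"
    unfolding compression_def by (intro norm_scale head_mem contr_mem[OF T0] assms)
  also have "\<dots> = (1 - \<delta>) * N (head n (T0 (head n x)))"
    using \<delta> by (simp only: norm_of_real)
  also have "\<dots> \<le> (1 - \<delta>) * N (head n x)"
    using \<delta> norm_head_le[OF contr_mem[OF T0 head_mem[OF assms]], of n n]
      contr_norm[OF T0 head_mem[OF assms], of n]
    by (intro mult_left_mono) auto
  finally show ?thesis .
qed

lemma compression_supp: "n \<le> i \<Longrightarrow> compression x i = 0"
  by (simp add: compression_def head_def)

lemma compression_head_eq_0: "head n x = (\<lambda>_. 0) \<Longrightarrow> compression x = (\<lambda>_. 0)"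
  by (simp add: compression_def contr_zero[OF T0] head_def)

lemma compression_unit_seq:
  "j < n \<Longrightarrow> compression (unit_seq j) = (\<lambda>i. complex_of_real (1 - \<delta>) * head n (T0 (unit_seq j)) i)"
  by (simp add: compression_def head_unit_seq)

definition diagonal_extension :: "complex \<Rightarrow> (nat \<Rightarrow> complex) \<Rightarrow> nat \<Rightarrow> complex" where
  "diagonal_extension \<mu> = (\<lambda>x\<in>X. \<lambda>i. compression x i + \<mu> * tail n x i)"

lemma diagonal_extension_unit_seq:
  "j < n \<Longrightarrow> diagonal_extension \<mu> (unit_seq j) = (\<lambda>i. complex_of_real (1 - \<delta>) * head n (T0 (unit_seq j)) i)"
  by (simp add: diagonal_extension_def unit_mem compression_unit_seq tail_unit_seq)

lemma diagonal_extension_eigen: "diagonal_extension \<mu> (unit_seq n) = (\<lambda>i. \<mu> * unit_seq n i)"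
proof -
  have "head n (unit_seq n) = (\<lambda>_. 0)" "tail n (unit_seq n) = unit_seq n"
    by (auto simp: head_def tail_def unit_seq_def)
  then show ?thesis
    by (simp add: diagonal_extension_def unit_mem compression_head_eq_0)
qed

text \<open>The compression lives on the coordinates below \<open>n\<close> and the multiple of the
  tail on the others, so \<open>norm_disjoint_add\<close> compares them separately with
  \<open>head n x\<close> and \<open>tail n x\<close>.\<close>

lemma diagonal_extension_contr:
  assumes \<mu>: "norm \<mu> \<le> 1"
  shows "diagonal_extension \<mu> \<in> contr"
proof (rule contractionI)
  have mem: "(\<lambda>i. compression x i + \<mu> * tail n x i) \<in> X" if "x \<in> X" for x
    by (intro add_mem scale_mem compression_mem tail_mem that)
  then show "diagonal_extension \<mu> \<in> X \<rightarrow>\<^sub>E X"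
    by (simp add: diagonal_extension_def)
  show "diagonal_extension \<mu> (\<lambda>i. x i + y i) = (\<lambda>i. diagonal_extension \<mu> x i + diagonal_extension \<mu> y i)"
    if "x \<in> X" "y \<in> X" for x y
    using that by (auto simp: diagonal_extension_def add_mem compression_add tail_add algebra_simps)
  show "diagonal_extension \<mu> (\<lambda>i. c * x i) = (\<lambda>i. c * diagonal_extension \<mu> x i)" if "x \<in> X" for c x
    using that by (auto simp: diagonal_extension_def scale_mem compression_scale tail_scale algebra_simps)
  show "N (diagonal_extension \<mu> x) \<le> N x" if x: "x \<in> X" for x
  proof -
    have "N (\<lambda>i. compression x i + \<mu> * tail n x i) \<le> N (\<lambda>i. head n x i + tail n x i)"
    proof (rule norm_disjoint_add)
      show "N (compression x) \<le> N (head n x)"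
        using compression_norm[OF x] \<delta> mult_left_le_one_le[OF norm_nonneg[OF head_mem[OF x, of n]], of "1 - \<delta>"] by simp
      show "N (\<lambda>i. \<mu> * tail n x i) \<le> N (tail n x)"
        using \<mu> norm_nonneg[OF tail_mem[OF x, of n]] by (simp add: norm_scale tail_mem x mult_left_le_one_le)
      show "compression x i = 0 \<or> \<mu> * tail n x i = 0" for i
        using compression_supp[of i x] by (cases "i < n") (auto simp: tail_def)
      show "head n x i = 0 \<or> tail n x i = 0" for i
        by (simp add: head_def tail_def)
    qed (intro compression_mem scale_mem head_mem tail_mem x)+
    then show ?thesis
      using x by (simp add: diagonal_extension_def head_plus_tail)
  qed
qed

text \<open>The shift brings the block from \<open>n\<close> to \<open>2 * n - 1\<close> onto the
  coordinates where the compression already acts. Its weight \<open>\<delta>\<close> there fits the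
  room left by the factor \<open>1 - \<delta>\<close>, so the sum stays contractive.\<close>

definition shift_extension :: "(nat \<Rightarrow> complex) \<Rightarrow> nat \<Rightarrow> complex" where
  "shift_extension = (\<lambda>x\<in>X. \<lambda>i. compression x i + (if i < n then complex_of_real \<delta> else 1) * x (i + n))"

lemma shift_extension_eq:
  "x \<in> X \<Longrightarrow> shift_extension x i = compression x i + (if i < n then complex_of_real \<delta> else 1) * x (i + n)"
  by (simp add: shift_extension_def)

lemma shift_extension_unit_seq:
  assumes "j < n"
  shows "shift_extension (unit_seq j) = (\<lambda>i. complex_of_real (1 - \<delta>) * head n (T0 (unit_seq j)) i)"
proof
  fix i
  have "unit_seq j (i + n) = 0"
    using assms by (simp add: unit_seq_def)
  then show "shift_extension (unit_seq j) i = complex_of_real (1 - \<delta>) * head n (T0 (unit_seq j)) i"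
    using assms by (simp add: shift_extension_eq unit_mem compression_unit_seq)
qed

lemma shift_extension_contr: "shift_extension \<in> contr"
proof (rule contractionI)
  \<comment> \<open>The cut is at \<open>2 * n\<close>: \<open>?u\<close> depends on the first
    \<open>2 * n\<close> coordinates and has support below \<open>n\<close>, while \<open>?v\<close>
    is the remainder moved to the coordinates from \<open>n\<close> on. This makes both pairs of
    supports disjoint.\<close>
  let ?u = "\<lambda>x. \<lambda>i. compression x i + complex_of_real \<delta> * head (2 * n) x (i + n)"
  let ?v = "\<lambda>x. \<lambda>i. tail (2 * n) x (i + n)"
  have split: "shift_extension x = (\<lambda>i. ?u x i + ?v x i)" if "x \<in> X" for x
    using that by (auto simp: shift_extension_eq head_def tail_def)
  have u_mem: "?u x \<in> X" and v_mem: "?v x \<in> X" if "x \<in> X" for x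
    using that by (intro add_mem scale_mem compression_mem shift_left_mem head_mem tail_mem; simp)+
  then show "shift_extension \<in> X \<rightarrow>\<^sub>E X"
    using add_mem split by (auto simp: shift_extension_def intro!: extensional_funcset_def)
  show "shift_extension (\<lambda>i. x i + y i) = (\<lambda>i. shift_extension x i + shift_extension y i)"
    if "x \<in> X" "y \<in> X" for x y
    using that by (auto simp: shift_extension_eq add_mem compression_add algebra_simps)
  show "shift_extension (\<lambda>i. c * x i) = (\<lambda>i. c * shift_extension x i)" if "x \<in> X" for c x
    using that by (auto simp: shift_extension_eq scale_mem compression_scale algebra_simps)
  show "N (shift_extension x) \<le> N x" if x: "x \<in> X" for x
  proof -
    have h: "head (2 * n) x \<in> X"
      by (rule head_mem[OF x])
    have "N (\<lambda>i. ?u x i + ?v x i) \<le> N (\<lambda>i. head (2 * n) x i + tail (2 * n) x i)"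
    proof (rule norm_disjoint_add)
      have "N (?u x) \<le> N (compression x) + \<delta> * N (\<lambda>i. head (2 * n) x (i + n))"
        using norm_add[OF compression_mem[OF x] scale_mem[OF shift_left_mem[OF h, of n], of "complex_of_real \<delta>"]] \<delta>
        by (simp add: norm_scale shift_left_mem h)
      also have "N (compression x) \<le> (1 - \<delta>) * N (head (2 * n) x)"
      proof -
        have "N (head n x) \<le> N (head (2 * n) x)"
          by (rule solid_norm[OF h]) (auto simp: head_def)
        then have "(1 - \<delta>) * N (head n x) \<le> (1 - \<delta>) * N (head (2 * n) x)"
          using \<delta> by (intro mult_left_mono) auto
        then show ?thesis
          using compression_norm[OF x] by simp
      qed
      also have "\<delta> * N (\<lambda>i. head (2 * n) x (i + n)) \<le> \<delta> * N (head (2 * n) x)"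
        using \<delta> by (intro mult_left_mono shift_left_norm h) auto
      finally show "N (?u x) \<le> N (head (2 * n) x)"
        by (simp add: algebra_simps)
      show "N (?v x) \<le> N (tail (2 * n) x)"
        by (intro shift_left_norm tail_mem x)
      show "?u x i = 0 \<or> ?v x i = 0" for i
        using compression_supp[of i x] by (cases "i < n") (auto simp: head_def tail_def)
      show "head (2 * n) x i = 0 \<or> tail (2 * n) x i = 0" for i
        by (simp add: head_def tail_def)
    qed (intro u_mem v_mem h tail_mem x)+
    then show ?thesis
      by (simp add: split x head_plus_tail)
  qed
qed

text \<open>Each application moves the end of the support \<open>n\<close> places to the left; the
  compression never creates entries at or beyond \<open>n\<close>.\<close>

lemma shift_extension_funpow_supp:
  assumes "y \<in> X" and "\<And>i. (k + 1) * n \<le> i \<Longrightarrow> y i = 0"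
  shows "n \<le> i \<Longrightarrow> (shift_extension ^^ k) y i = 0"
  using assms
proof (induction k arbitrary: y i)
  case (Suc k)
  have "shift_extension y i = 0" if "(k + 1) * n \<le> i" for i
  proof -
    have "n \<le> i"
      using that by simp
    then show ?thesis
      using Suc.prems(2) Suc.prems(3)[of "i + n"] that
      by (simp add: shift_extension_eq compression_supp)
  qed
  then have "(shift_extension ^^ k) (shift_extension y) i = 0"
    by (intro Suc.IH Suc.prems contr_mem[OF shift_extension_contr])
  then show ?case
    by (simp add: funpow_Suc_right del: funpow.simps)
qed simp

text \<open>On vectors supported below \<open>n\<close> the shift part vanishes and only the
  compression acts, with factor at most \<open>1 - \<delta>\<close>. The support condition belongs
  to the induction, since it makes the next step a compression again.\<close>

lemma shift_extension_funpow_decay: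
  assumes "z \<in> X" and "\<And>i. n \<le> i \<Longrightarrow> z i = 0"
  shows "N ((shift_extension ^^ l) z) \<le> (1 - \<delta>) ^ l * N z \<and> (\<forall>i\<ge>n. (shift_extension ^^ l) z i = 0)"
proof (induction l)
  case 0
  then show ?case
    using assms by simp
next
  case (Suc l)
  let ?w = "(shift_extension ^^ l) z"
  have w: "?w \<in> X"
    by (rule funpow_mem[OF shift_extension_contr assms(1)])
  have eq: "shift_extension ?w = compression ?w"
    using Suc w by (auto simp: shift_extension_eq)
  have "N (compression ?w) \<le> (1 - \<delta>) * N (head n ?w)"
    by (rule compression_norm[OF w])
  also have "\<dots> \<le> (1 - \<delta>) * N ?w"
    using \<delta> by (intro mult_left_mono norm_head_le w) auto
  also have "\<dots> \<le> (1 - \<delta>) * ((1 - \<delta>) ^ l * N z)"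
    using \<delta> Suc by (intro mult_left_mono) auto
  finally show ?case
    using eq by (simp add: compression_supp mult.assoc)
qed

lemma shift_extension_funpow_small:
  assumes "\<epsilon> > 0"
  shows "\<exists>k. N ((shift_extension ^^ k) (unit_seq j)) < \<epsilon>"
proof -
  \<comment> \<open>Because \<open>n\<close> is positive, \<open>j < (j + 1) * n\<close>; so
    \<open>j\<close> applications bring the support below \<open>n\<close>, where the geometric
    decay starts.\<close>
  let ?z = "(shift_extension ^^ j) (unit_seq j)"
  have z: "?z \<in> X"
    by (rule funpow_mem[OF shift_extension_contr unit_mem])
  have supp: "?z i = 0" if "n \<le> i" for i
  proof (rule shift_extension_funpow_supp[OF unit_mem _ that])
    fix i
    assume "(j + 1) * n \<le> i"
    moreover have "j < (j + 1) * n"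
      using n by (cases n) auto
    ultimately show "unit_seq j i = 0"
      by (simp add: unit_seq_def)
  qed
  have "(\<lambda>l. (1 - \<delta>) ^ l * N ?z) \<longlonglongrightarrow> 0"
    using \<delta> by (intro tendsto_mult_left_zero LIMSEQ_realpow_zero) auto
  then have "\<forall>\<^sub>F l in sequentially. (1 - \<delta>) ^ l * N ?z < \<epsilon>"
    using assms by (rule order_tendstoD(2))
  then obtain l where "(1 - \<delta>) ^ l * N ?z < \<epsilon>"
    by (auto simp: eventually_sequentially)
  then have "N ((shift_extension ^^ l) ?z) < \<epsilon>"
    using shift_extension_funpow_decay[OF z supp, of l] by simp
  then show ?thesis
    by (metis funpow_add comp_apply)
qed

lemma shift_extension_preimages:
  assumes "0 \<le> s" "s < 1" "\<epsilon> > 0"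
  shows "\<exists>k. \<exists>u\<in>X. (shift_extension ^^ k) u = unit_seq j \<and> s ^ k * N u < \<epsilon>"
proof -
  let ?e = "unit_seq j"
  \<comment> \<open>The factor \<open>1 / \<delta>\<close> cancels the damping, which is met only in
    the last application and only if \<open>j < n\<close>.\<close>
  let ?w = "\<lambda>i. (if i < n then complex_of_real (1 / \<delta>) else 1) * ?e i"
  \<comment> \<open>Moving by \<open>Suc k\<close> blocks, not \<open>k\<close>, leaves the first
    \<open>n\<close> coordinates zero, so the compression does not see \<open>?u k\<close>. Right
    shifts do not increase the norm, hence all \<open>?u k\<close> are bounded by
    \<open>N ?w\<close> and \<open>s ^ Suc k\<close> makes the product small.\<close>
  let ?u = "\<lambda>k i. if i < Suc k * n then 0 else ?w (i - Suc k * n)"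
  have w: "?w \<in> X"
  proof (rule solid_mem)
    show "norm (?w i) \<le> norm (complex_of_real (1 / \<delta>) * ?e i)" for i
      using \<delta> by (auto simp: unit_seq_def norm_divide field_simps)
  qed (intro scale_mem unit_mem)
  have u: "?u k \<in> X" "N (?u k) \<le> N ?w" for k
    using shift_right_mem[OF w, of "Suc k * n"] shift_right_norm[OF w, of "Suc k * n"] by auto
  have head_u: "compression (?u k) = (\<lambda>_. 0)" for k
    by (rule compression_head_eq_0) (auto simp: head_def)
  have step: "shift_extension (?u (Suc k)) = ?u k" for k
  proof
    fix i
    show "shift_extension (?u (Suc k)) i = ?u k i"
      unfolding shift_extension_eq[OF u(1)] head_u by (cases "i < n") auto
  qed
  have first: "shift_extension (?u 0) = ?e"
  proof
    fix i
    show "shift_extension (?u 0) i = ?e i"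
      unfolding shift_extension_eq[OF u(1)] head_u using \<delta> by (cases "i < n") auto
  qed
  have funpow: "(shift_extension ^^ Suc k) (?u k) = ?e" for k
  proof (induction k)
    case 0
    show ?case
      using first by simp
  next
    case (Suc k)
    have "(shift_extension ^^ Suc (Suc k)) (?u (Suc k)) = (shift_extension ^^ Suc k) (shift_extension (?u (Suc k)))"
      by (simp only: funpow_Suc_right comp_apply)
    then show ?case
      unfolding step Suc .
  qed
  have "(\<lambda>k. s ^ Suc k * N ?w) \<longlonglongrightarrow> 0"
    using assms by (intro tendsto_mult_left_zero LIMSEQ_Suc LIMSEQ_realpow_zero) auto
  then have "\<forall>\<^sub>F k in sequentially. s ^ Suc k * N ?w < \<epsilon>"
    using assms(3) by (rule order_tendstoD(2))
  then obtain k where k: "s ^ Suc k * N ?w < \<epsilon>"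
    by (auto simp: eventually_sequentially)
  have "s ^ Suc k * N (?u k) \<le> s ^ Suc k * N ?w"
    using assms u(2) by (intro mult_left_mono) auto
  then have "s ^ Suc k * N (?u k) < \<epsilon>"
    using k by simp
  then show ?thesis
    using funpow[of k] u(1)[of k] by blast
qed

end

section \<open>Countably many dense open conditions\<close>

definition orbit_small :: "nat \<Rightarrow> nat \<Rightarrow> ((nat \<Rightarrow> complex) \<Rightarrow> nat \<Rightarrow> complex) set" where
  "orbit_small j i = (\<Union>k. {T \<in> contr. D ((T ^^ k) (unit_seq j)) (\<lambda>_. 0) < inverse (real (Suc i))})"

text \<open>The bound \<open>s\<close> of the introduction runs through
  \<open>1 - 1 / (l + 1)\<close> and \<open>\<epsilon>\<close> through \<open>1 / (i + 1)\<close>,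
  so there are countably many such sets. The union over all \<open>u\<close> may be uncountable
  without harming openness.\<close>

definition small_preimage :: "nat \<Rightarrow> nat \<Rightarrow> nat \<Rightarrow> ((nat \<Rightarrow> complex) \<Rightarrow> nat \<Rightarrow> complex) set" where
  "small_preimage j i l =
     (\<Union>(k, u) \<in> {(k, u). u \<in> X \<and> (1 - inverse (real (Suc l))) ^ k * N u < inverse (real (Suc i))}.
       {T \<in> contr. D ((T ^^ k) u) (unit_seq j) < inverse (real (Suc i))})"

text \<open>The inequality is strict for two reasons: it is open in \<open>T\<close> for fixed
  \<open>x\<close>, and it fails for \<open>x = 0\<close>.\<close>

definition near_eigen :: "complex \<Rightarrow> nat \<Rightarrow> ((nat \<Rightarrow> complex) \<Rightarrow> nat \<Rightarrow> complex) set" where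
  "near_eigen \<nu> i =
     (\<Union>x\<in>X. {T \<in> contr. D (T x) (\<lambda>n. \<nu> * x n) < inverse (real (Suc i)) * N x})"

lemma openin_orbit_small: "openin (sot_contractions X N) (orbit_small j i)"
  unfolding orbit_small_def by (intro openin_Union ballI) (auto intro: openin_sot_funpow unit_mem zero_mem)

lemma openin_small_preimage: "openin (sot_contractions X N) (small_preimage j i l)"
  unfolding small_preimage_def by (intro openin_Union ballI) (auto intro: openin_sot_funpow unit_mem)

lemma openin_near_eigen: "openin (sot_contractions X N) (near_eigen \<nu> i)"
  unfolding near_eigen_def by (intro openin_Union ballI) (auto intro!: openin_sot_funpow[where k = 1, simplified] scale_mem)

text \<open>The shift extension is chosen from \<open>T0\<close> and \<open>r\<close> alone, so one
  operator serves every index at once.\<close>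

lemma dense_orbit_small_preimage:
  assumes "T0 \<in> contr" "r > 0"
  shows "\<exists>T. (\<forall>j i l. T \<in> orbit_small j i \<and> T \<in> small_preimage j i l) \<and> sot_dist T0 T < r"
proof -
  obtain n \<delta> where n: "0 < n" and \<delta>: "0 < \<delta>" "\<delta> < 1"
    and close: "\<And>T. (\<forall>j<n. T (unit_seq j) = (\<lambda>i. complex_of_real (1 - \<delta>) * head n (T0 (unit_seq j)) i))
      \<Longrightarrow> sot_dist T0 T < r"
    using approximation_by_compressions[OF assms] by blast
  define T where "T = shift_extension T0 n \<delta>"
  note facts = assms(1) n \<delta>
  have T: "T \<in> contr"
    unfolding T_def by (rule shift_extension_contr[OF facts])
  have "sot_dist T0 T < r"
    unfolding T_def by (rule close) (use shift_extension_unit_seq[OF facts] in blast)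
  moreover have "T \<in> orbit_small j i" for j i
  proof -
    obtain k where "N ((T ^^ k) (unit_seq j)) < inverse (real (Suc i))"
      unfolding T_def using shift_extension_funpow_small[OF facts, of "inverse (real (Suc i))" j] by auto
    then have "D ((T ^^ k) (unit_seq j)) (\<lambda>_. 0) < inverse (real (Suc i))"
      by (simp add: D_zero funpow_mem[OF T unit_mem])
    then show ?thesis
      using T unfolding orbit_small_def by blast
  qed
  moreover have "T \<in> small_preimage j i l" for j i l
  proof -
    have "0 \<le> 1 - inverse (real (Suc l))" "1 - inverse (real (Suc l)) < 1"
      by (auto simp: field_simps)
    then obtain k u where u: "u \<in> X" "(T ^^ k) u = unit_seq j"
      "(1 - inverse (real (Suc l))) ^ k * N u < inverse (real (Suc i))"
      unfolding T_def
      using shift_extension_preimages[OF facts, of "1 - inverse (real (Suc l))" "inverse (real (Suc i))" j]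
      by (metis inverse_positive_iff_positive of_nat_0_less_iff zero_less_Suc)
    then have "D ((T ^^ k) u) (unit_seq j) < inverse (real (Suc i))"
      by (simp add: unit_mem)
    then show ?thesis
      using T u unfolding small_preimage_def by blast
  qed
  ultimately show ?thesis
    by blast
qed

text \<open>The diagonal extension has \<open>\<nu>\<close> as an exact eigenvalue, with eigenvector
  \<open>unit_seq n\<close>, the first one not involved in the approximation of
  \<open>T0\<close>.\<close>

lemma dense_near_eigen:
  assumes "T0 \<in> contr" "r > 0" and \<nu>: "norm \<nu> \<le> 1"
  shows "\<exists>T\<in>near_eigen \<nu> i. sot_dist T0 T < r"
proof -
  obtain n \<delta> where n: "0 < n" and \<delta>: "0 < \<delta>" "\<delta> < 1"
    and close: "\<And>T. (\<forall>j<n. T (unit_seq j) = (\<lambda>i. complex_of_real (1 - \<delta>) * head n (T0 (unit_seq j)) i))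
      \<Longrightarrow> sot_dist T0 T < r"
    using approximation_by_compressions[OF assms(1,2)] by blast
  define T where "T = diagonal_extension T0 n \<delta> \<nu>"
  note facts = assms(1) n \<delta>
  have T: "T \<in> contr"
    unfolding T_def by (rule diagonal_extension_contr[OF facts \<nu>])
  have "T (unit_seq n) = (\<lambda>i. \<nu> * unit_seq n i)"
    unfolding T_def by (rule diagonal_extension_eigen[OF facts])
  then have "D (T (unit_seq n)) (\<lambda>i. \<nu> * unit_seq n i) < inverse (real (Suc i)) * N (unit_seq n)"
    using norm_unit_pos[of n] by (simp add: scale_mem unit_mem)
  then have "T \<in> near_eigen \<nu> i"
    using T unit_mem unfolding near_eigen_def by blast
  moreover have "sot_dist T0 T < r"
    unfolding T_def by (rule close) (use diagonal_extension_unit_seq[OF facts] in blast)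
  ultimately show ?thesis
    by blast
qed

theorem typical_contraction_spectrum:
  "typical_contraction X N
     (\<lambda>T. (\<forall>\<mu>. dense_range X N (minus_scalar X T \<mu>)) \<and>
          op_spectrum X N T = closure (ball 0 1) \<and>
          approx_point_spectrum X N T = closure (ball 0 1))"
proof -
  \<comment> \<open>Countability of \<open>Q\<close> keeps the family countable, \<open>Q\<close>
    inside the disc lets the diagonal extensions be contractions, and density recovers the whole
    disc afterwards.\<close>
  obtain Q :: "complex set" where Q: "countable Q" "Q \<subseteq> cball 0 1" "cball 0 1 \<subseteq> closure Q"
    using separable[of "cball 0 1 :: complex set"] by blast
  define \<G> where "\<G> = range (\<lambda>(j, i). orbit_small j i) \<union> range (\<lambda>(j, i, l). small_preimage j i l)
    \<union> (\<lambda>(\<nu>, i). near_eigen \<nu> i) ` (Q \<times> UNIV)"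
  show ?thesis
  proof (rule typical_contractionI[of \<G>])
    show "countable \<G>"
      unfolding \<G>_def using Q(1) by auto
    show "openin (sot_contractions X N) G" if "G \<in> \<G>" for G
      using that openin_orbit_small openin_small_preimage openin_near_eigen by (auto simp: \<G>_def)
    show "\<exists>S\<in>G. sot_dist T S < r" if "G \<in> \<G>" "T \<in> contr" "r > 0" for G T r
    proof -
      have "\<exists>S\<in>near_eigen \<nu> i. sot_dist T S < r" if "\<nu> \<in> Q" for \<nu> i
        using dense_near_eigen[OF \<open>T \<in> contr\<close> \<open>r > 0\<close>] that Q(2) by auto
      moreover obtain S where "\<And>j i l. S \<in> orbit_small j i \<and> S \<in> small_preimage j i l" "sot_dist T S < r"
        using dense_orbit_small_preimage[OF \<open>T \<in> contr\<close> \<open>r > 0\<close>] by blast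
      ultimately show ?thesis
        using \<open>G \<in> \<G>\<close> by (auto simp: \<G>_def)
    qed
    fix T
    assume T: "T \<in> contr" and all: "\<And>G. G \<in> \<G> \<Longrightarrow> T \<in> G"
    have orbit: "T \<in> orbit_small j i" and preimage: "T \<in> small_preimage j i l" for j i l
      by (rule all, force simp: \<G>_def)+
    have near: "T \<in> near_eigen \<nu> i" if "\<nu> \<in> Q" for \<nu> i
      by (rule all) (use that in \<open>force simp: \<G>_def\<close>)
    have dense: "dense_range X N (minus_scalar X T \<mu>)" for \<mu>
    proof (cases "norm \<mu> \<ge> 1")
      case True
      show ?thesis
      proof (rule dense_range_ge_1[OF T True])
        fix j and \<epsilon> :: real
        assume "\<epsilon> > 0"
        then obtain i where i: "inverse (real (Suc i)) < \<epsilon>"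
          using reals_Archimedean by blast
        obtain k where "D ((T ^^ k) (unit_seq j)) (\<lambda>_. 0) < inverse (real (Suc i))"
          using orbit[of j i] unfolding orbit_small_def by blast
        then show "\<exists>k. N ((T ^^ k) (unit_seq j)) < \<epsilon>"
          using i by (intro exI[of _ k]) (simp add: D_zero funpow_mem[OF T unit_mem])
      qed
    next
      case False
      \<comment> \<open>This \<open>l\<close> makes \<open>s = 1 - 1 / (l + 1)\<close> an upper
        bound for the modulus of \<open>\<mu>\<close>.\<close>
      then obtain l where l: "inverse (real (Suc l)) < 1 - norm \<mu>"
        using reals_Archimedean[of "1 - norm \<mu>"] by auto
      show ?thesis
      proof (rule dense_range_less_1[OF T])
        show "norm \<mu> \<le> 1 - inverse (real (Suc l))"
          using l by simp
        fix j and \<epsilon> :: real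
        assume "\<epsilon> > 0"
        then obtain i where i: "inverse (real (Suc i)) < \<epsilon>"
          using reals_Archimedean by blast
        obtain k u where "u \<in> X" "(1 - inverse (real (Suc l))) ^ k * N u < inverse (real (Suc i))"
          "D ((T ^^ k) u) (unit_seq j) < inverse (real (Suc i))"
          using preimage[of j i l] unfolding small_preimage_def by blast
        then show "\<exists>k. \<exists>u\<in>X. D ((T ^^ k) u) (unit_seq j) < \<epsilon> \<and> (1 - inverse (real (Suc l))) ^ k * N u < \<epsilon>"
          using i less_trans by blast
      qed
    qed
    have "\<exists>x\<in>X. D (T x) (\<lambda>n. \<nu> * x n) < \<epsilon> * N x" if "\<nu> \<in> Q" "\<epsilon> > 0" for \<nu> \<epsilon>
    proof -
      obtain i where i: "inverse (real (Suc i)) < \<epsilon>"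
        using reals_Archimedean[OF \<open>\<epsilon> > 0\<close>] by blast
      obtain x where x: "x \<in> X" "D (T x) (\<lambda>n. \<nu> * x n) < inverse (real (Suc i)) * N x"
        using near[OF \<open>\<nu> \<in> Q\<close>, of i] unfolding near_eigen_def by auto
      moreover have "inverse (real (Suc i)) * N x \<le> \<epsilon> * N x"
        using i by (intro mult_right_mono norm_nonneg x(1)) simp
      ultimately show ?thesis
        by (intro bexI[of _ x]) auto
    qed
    then have "\<not> bounded_below X N (minus_scalar X T \<mu>)" if "norm \<mu> \<le> 1" for \<mu>
      using that Q(3) by (intro not_bounded_below_closure[OF T, of \<mu> Q]) auto
    then show "(\<forall>\<mu>. dense_range X N (minus_scalar X T \<mu>)) \<and>
          op_spectrum X N T = closure (ball 0 1) \<and>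
          approx_point_spectrum X N T = closure (ball 0 1)"
      using spectrum_eq_cball[OF T dense] dense by simp
  qed
qed

end

section \<open>The spaces lp and c0\<close>

lemma powr_convex_nonneg:
  fixes p t u v :: real
  assumes p: "1 \<le> p" and t: "0 \<le> t" "t \<le> 1" and uv: "0 \<le> u" "0 \<le> v"
  shows "(t * u + (1 - t) * v) powr p \<le> t * u powr p + (1 - t) * v powr p"
proof -
  have scaled: "(s * w) powr p \<le> s * w powr p" if "0 \<le> s" "s \<le> 1" "0 \<le> w" for s w :: real
  proof (cases "s = 0")
    case False
    then have "s powr p \<le> s powr 1"
      using that p by (intro powr_mono') auto
    then show ?thesis
      using that by (simp add: powr_mult mult_right_mono)
  qed (use p in simp)
  \<comment> \<open>If one of the points is 0, the claim reduces to \<open>s powr p \<le> s\<close>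
    on the unit interval; otherwise it is convexity on the positive reals.\<close>
  consider "u = 0" | "v = 0" | "0 < u" "0 < v"
    using uv by linarith
  then show ?thesis
  proof cases
    case 1
    then show ?thesis
      using scaled[of "1 - t" v] t uv p by simp
  next
    case 2
    then show ?thesis
      using scaled[of t u] t uv p by simp
  next
    case 3
    then show ?thesis
      using convex_onD[OF powr_convex[OF p], of "1 - t" u v] t by simp
  qed
qed

text \<open>This p-th power of the norm is additive over disjoint supports, so estimates are made
  for it and carried over to \<open>lp_norm\<close> by monotonicity.\<close>

definition lp_sum :: "real \<Rightarrow> (nat \<Rightarrow> complex) \<Rightarrow> real" where
  "lp_sum p x = (\<Sum>n. norm (x n) powr p)"

lemma lp_sum_nonneg: "x \<in> lp_space p \<Longrightarrow> 0 \<le> lp_sum p x"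
  by (simp add: lp_sum_def lp_space_def suminf_nonneg)

lemma lp_norm_eq: "lp_norm p x = lp_sum p x powr (1 / p)"
  by (simp add: lp_norm_def lp_sum_def)

lemma lp_norm_nonneg: "0 \<le> lp_norm p x"
  by (simp add: lp_norm_eq)

lemma lp_norm_powr: "\<lbrakk>1 \<le> p; x \<in> lp_space p\<rbrakk> \<Longrightarrow> lp_norm p x powr p = lp_sum p x"
  by (simp add: lp_norm_eq powr_powr lp_sum_nonneg)

lemma lp_norm_leI:
  assumes "1 \<le> p" "x \<in> lp_space p" "0 \<le> c" "lp_sum p x \<le> c powr p"
  shows "lp_norm p x \<le> c"
proof -
  have "lp_sum p x powr (1 / p) \<le> (c powr p) powr (1 / p)"
    using assms by (intro powr_mono2 lp_sum_nonneg) auto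
  then show ?thesis
    using assms by (simp add: lp_norm_eq powr_powr)
qed

lemma lp_norm_mono:
  assumes "1 \<le> p" "x \<in> lp_space p" "lp_sum p x \<le> lp_sum p y"
  shows "lp_norm p x \<le> lp_norm p y"
  unfolding lp_norm_eq using assms by (intro powr_mono2 lp_sum_nonneg) auto

lemma lp_coord_le:
  assumes "1 \<le> p" "x \<in> lp_space p"
  shows "norm (x i) \<le> lp_norm p x"
proof -
  have "norm (x i) powr p \<le> lp_sum p x"
    using sum_le_suminf[of "\<lambda>n. norm (x n) powr p" "{i}"] assms by (simp add: lp_sum_def lp_space_def)
  then have "(norm (x i) powr p) powr (1 / p) \<le> lp_sum p x powr (1 / p)"
    using assms(1) by (intro powr_mono2) auto
  then show ?thesis
    using assms(1) by (simp add: lp_norm_eq powr_powr)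
qed

lemma lp_norm_eq_0: "\<lbrakk>1 \<le> p; x \<in> lp_space p; lp_norm p x = 0\<rbrakk> \<Longrightarrow> x = (\<lambda>_. 0)"
  using lp_coord_le[of p x] by (intro ext) (metis norm_le_zero_iff)

lemma lp_solid:
  assumes "1 \<le> p" "y \<in> lp_space p" "\<And>n. norm (x n) \<le> norm (y n)"
  shows "x \<in> lp_space p" "lp_norm p x \<le> lp_norm p y"
proof -
  have le: "norm (x n) powr p \<le> norm (y n) powr p" for n
    using assms by (intro powr_mono2) auto
  have y: "summable (\<lambda>n. norm (y n) powr p)"
    using assms(2) by (simp add: lp_space_def)
  then have "summable (\<lambda>n. norm (x n) powr p)"
    by (rule summable_comparison_test'[where N = 0]) (simp add: le)
  then show x: "x \<in> lp_space p"
    by (simp add: lp_space_def)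
  show "lp_norm p x \<le> lp_norm p y"
    using le y x by (intro lp_norm_mono[OF assms(1) x]) (simp add: lp_sum_def lp_space_def suminf_le)
qed

lemma lp_scale:
  assumes "1 \<le> p" "x \<in> lp_space p"
  shows "(\<lambda>n. c * x n) \<in> lp_space p" "lp_norm p (\<lambda>n. c * x n) = norm c * lp_norm p x"
proof -
  have eq: "(\<lambda>n. norm (c * x n) powr p) = (\<lambda>n. norm c powr p * norm (x n) powr p)"
    by (simp add: norm_mult powr_mult)
  have x: "summable (\<lambda>n. norm (x n) powr p)"
    using assms(2) by (simp add: lp_space_def)
  then show "(\<lambda>n. c * x n) \<in> lp_space p"
    unfolding lp_space_def mem_Collect_eq eq by (rule summable_mult)
  have "lp_sum p (\<lambda>n. c * x n) = norm c powr p * lp_sum p x"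
    unfolding lp_sum_def eq by (rule suminf_mult[OF x])
  then show "lp_norm p (\<lambda>n. c * x n) = norm c * lp_norm p x"
    using assms lp_sum_nonneg[OF assms(2)] by (simp add: lp_norm_eq powr_mult powr_powr)
qed

text \<open>Normalise both vectors and apply convexity of the p-th power coordinatewise to
  \<open>(a + b) * (t * (x / a) + (1 - t) * (y / b))\<close>. Summing gives
  \<open>(a + b) powr p\<close>. The cases \<open>a = 0\<close> and \<open>b = 0\<close>, where
  normalisation fails, are trivial.\<close>

lemma lp_Minkowski:
  assumes p: "1 \<le> p" and x: "x \<in> lp_space p" and y: "y \<in> lp_space p"
  shows "(\<lambda>n. x n + y n) \<in> lp_space p \<and> lp_norm p (\<lambda>n. x n + y n) \<le> lp_norm p x + lp_norm p y"
proof -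
  define a b where "a = lp_norm p x" and "b = lp_norm p y"
  have nonneg: "0 \<le> a" "0 \<le> b"
    by (simp_all add: a_def b_def lp_norm_nonneg)
  consider "a = 0" | "b = 0" | "0 < a" "0 < b"
    using nonneg by linarith
  then show ?thesis
  proof cases
    case 1
    then have "x = (\<lambda>_. 0)"
      using lp_norm_eq_0[OF p x] by (simp add: a_def)
    then show ?thesis
      using y lp_norm_nonneg[of p x] by simp
  next
    case 2
    then have "y = (\<lambda>_. 0)"
      using lp_norm_eq_0[OF p y] by (simp add: b_def)
    then show ?thesis
      using x lp_norm_nonneg[of p y] by simp
  next
    case 3
    define t where "t = a / (a + b)"
    have t: "0 \<le> t" "t \<le> 1" "1 - t = b / (a + b)"
      using 3 by (auto simp: t_def field_simps)
    \<comment> \<open>These are the coefficients of the two p-th powers after convexity; by design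
      \<open>A * a powr p + B * b powr p\<close> collapses to \<open>(a + b) powr p\<close>.\<close>
    define A B where "A = (a + b) powr p * t / a powr p" and "B = (a + b) powr p * (1 - t) / b powr p"
    have bound: "norm (x n + y n) powr p \<le> A * norm (x n) powr p + B * norm (y n) powr p" for n
    proof -
      have "norm (x n) + norm (y n) = (a + b) * (t * (norm (x n) / a) + (1 - t) * (norm (y n) / b))"
      proof -
        have "(a + b) * t = a" "(a + b) * (1 - t) = b"
          unfolding t(3) using 3 by (simp_all add: t_def)
        then have "(a + b) * (t * u + (1 - t) * v) = a * u + b * v" for u v
          by (metis distrib_left mult.assoc)
        then have "(a + b) * (t * (norm (x n) / a) + (1 - t) * (norm (y n) / b))
            = a * (norm (x n) / a) + b * (norm (y n) / b)"
          by blast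
        also have "\<dots> = norm (x n) + norm (y n)"
          using 3 by simp
        finally show ?thesis ..
      qed
      then have "norm (x n + y n) powr p \<le> ((a + b) * (t * (norm (x n) / a) + (1 - t) * (norm (y n) / b))) powr p"
        using p norm_triangle_ineq[of "x n" "y n"] by (intro powr_mono2) auto
      also have "\<dots> = (a + b) powr p * (t * (norm (x n) / a) + (1 - t) * (norm (y n) / b)) powr p"
        by (rule powr_mult)
      also have "\<dots> \<le> (a + b) powr p * (t * (norm (x n) / a) powr p + (1 - t) * (norm (y n) / b) powr p)"
        using 3 t by (intro mult_left_mono powr_convex_nonneg p) auto
      also have "\<dots> = A * norm (x n) powr p + B * norm (y n) powr p"
        using 3 by (simp add: A_def B_def powr_divide algebra_simps)
      finally show ?thesis .
    qed
    have sx: "summable (\<lambda>n. norm (x n) powr p)" and sy: "summable (\<lambda>n. norm (y n) powr p)"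
      using x y by (simp_all add: lp_space_def)
    have sAB: "summable (\<lambda>n. A * norm (x n) powr p + B * norm (y n) powr p)"
      by (intro summable_add summable_mult sx sy)
    then have s: "summable (\<lambda>n. norm (x n + y n) powr p)"
      by (rule summable_comparison_test'[where N = 0]) (simp add: bound)
    then have mem: "(\<lambda>n. x n + y n) \<in> lp_space p"
      by (simp add: lp_space_def)
    have "lp_sum p (\<lambda>n. x n + y n) \<le> (\<Sum>n. A * norm (x n) powr p + B * norm (y n) powr p)"
      unfolding lp_sum_def by (intro suminf_le bound s sAB)
    also have "\<dots> = A * lp_sum p x + B * lp_sum p y"
      unfolding lp_sum_def by (subst suminf_add[symmetric]) (auto intro: summable_mult sx sy simp: suminf_mult sx sy)
    also have "\<dots> = A * a powr p + B * b powr p"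
      by (simp add: a_def b_def lp_norm_powr p x y)
    also have "\<dots> = (a + b) powr p"
    proof -
      have "A * a powr p = (a + b) powr p * t" "B * b powr p = (a + b) powr p * (1 - t)"
        using 3 by (simp_all add: A_def B_def)
      then show ?thesis
        by (simp add: algebra_simps)
    qed
    finally have "lp_norm p (\<lambda>n. x n + y n) \<le> a + b"
      using nonneg by (intro lp_norm_leI p mem) auto
    then show ?thesis
      using mem by (simp add: a_def b_def)
  qed
qed

lemma lp_diff_mem: "\<lbrakk>1 \<le> p; x \<in> lp_space p; y \<in> lp_space p\<rbrakk> \<Longrightarrow> (\<lambda>n. x n - y n) \<in> lp_space p"
  using lp_Minkowski[of p x "\<lambda>n. - 1 * y n"] lp_scale(1)[of p y "- 1"] by simp

lemma lp_split_initial_segment: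
  assumes "x \<in> lp_space p"
  shows "(\<lambda>i. x (i + m)) \<in> lp_space p"
    and "lp_sum p x = lp_sum p (\<lambda>i. x (i + m)) + (\<Sum>i<m. norm (x i) powr p)"
proof -
  have s: "summable (\<lambda>n. norm (x n) powr p)"
    using assms by (simp add: lp_space_def)
  then show "(\<lambda>i. x (i + m)) \<in> lp_space p"
    unfolding lp_space_def mem_Collect_eq by (rule summable_ignore_initial_segment)
  show "lp_sum p x = lp_sum p (\<lambda>i. x (i + m)) + (\<Sum>i<m. norm (x i) powr p)"
    unfolding lp_sum_def by (rule suminf_split_initial_segment[OF s])
qed

lemma lp_shift_right_mem:
  assumes "x \<in> lp_space p"
  shows "(\<lambda>i. if i < m then 0 else x (i - m)) \<in> lp_space p"
proof -
  have "summable (\<lambda>i. norm ((\<lambda>i. if i < m then 0 else x (i - m)) (i + m)) powr p)"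
    using assms by (simp add: lp_space_def)
  then show ?thesis
    unfolding lp_space_def mem_Collect_eq by (rule summable_iff_shift[THEN iffD1])
qed

text \<open>Coordinatewise limits exist because coordinates are bounded by the norm. The Cauchy
  estimate passes to the limit in each finite partial sum, uniformly in the length, which yields
  membership of the difference and its norm bound together.\<close>

lemma lp_complete:
  assumes p: "1 \<le> p" and mem: "\<And>n. \<sigma> n \<in> lp_space p"
    and cauchy: "\<And>\<epsilon>. \<epsilon> > 0 \<Longrightarrow> \<exists>M. \<forall>m\<ge>M. \<forall>n\<ge>M. lp_norm p (\<lambda>i. \<sigma> m i - \<sigma> n i) < \<epsilon>"
  shows "\<exists>x\<in>lp_space p. (\<lambda>n. lp_norm p (\<lambda>i. \<sigma> n i - x i)) \<longlonglongrightarrow> 0"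
proof -
  have "Cauchy (\<lambda>n. \<sigma> n i)" for i
  proof (rule metric_CauchyI)
    fix \<epsilon> :: real
    assume "\<epsilon> > 0"
    then obtain M where "\<And>m n. \<lbrakk>m \<ge> M; n \<ge> M\<rbrakk> \<Longrightarrow> lp_norm p (\<lambda>i. \<sigma> m i - \<sigma> n i) < \<epsilon>"
      using cauchy by blast
    then show "\<exists>M. \<forall>m\<ge>M. \<forall>n\<ge>M. dist (\<sigma> m i) (\<sigma> n i) < \<epsilon>"
      using lp_coord_le[OF p lp_diff_mem[OF p mem mem], where i = i] unfolding dist_norm
      by (meson le_less_trans)
  qed
  then obtain x where x: "(\<lambda>n. \<sigma> n i) \<longlonglongrightarrow> x i" for i
    unfolding Cauchy_convergent_iff convergent_def by metis
  have close: "\<exists>M. \<forall>m\<ge>M. (\<lambda>i. \<sigma> m i - x i) \<in> lp_space p \<and> lp_norm p (\<lambda>i. \<sigma> m i - x i) \<le> \<epsilon>" if "\<epsilon> > 0" for \<epsilon>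
  proof -
    obtain M where M: "\<And>m n. \<lbrakk>m \<ge> M; n \<ge> M\<rbrakk> \<Longrightarrow> lp_norm p (\<lambda>i. \<sigma> m i - \<sigma> n i) < \<epsilon>"
      using cauchy[OF \<open>\<epsilon> > 0\<close>] by blast
    have "(\<lambda>i. \<sigma> m i - x i) \<in> lp_space p \<and> lp_norm p (\<lambda>i. \<sigma> m i - x i) \<le> \<epsilon>" if m: "m \<ge> M" for m
    proof -
      have partial: "(\<Sum>i<K. norm (\<sigma> m i - x i) powr p) \<le> \<epsilon> powr p" for K
      proof (rule LIMSEQ_le_const2)
        show "(\<lambda>n. \<Sum>i<K. norm (\<sigma> m i - \<sigma> n i) powr p) \<longlonglongrightarrow> (\<Sum>i<K. norm (\<sigma> m i - x i) powr p)"
          using p by (intro tendsto_sum tendsto_powr2 tendsto_norm tendsto_diff tendsto_const x) auto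
        have "(\<Sum>i<K. norm (\<sigma> m i - \<sigma> n i) powr p) \<le> \<epsilon> powr p" if n: "n \<ge> M" for n
        proof -
          have d: "(\<lambda>i. \<sigma> m i - \<sigma> n i) \<in> lp_space p"
            by (rule lp_diff_mem[OF p mem mem])
          have "(\<Sum>i<K. norm (\<sigma> m i - \<sigma> n i) powr p) \<le> lp_sum p (\<lambda>i. \<sigma> m i - \<sigma> n i)"
            using d unfolding lp_sum_def by (intro sum_le_suminf) (auto simp: lp_space_def)
          also have "\<dots> = lp_norm p (\<lambda>i. \<sigma> m i - \<sigma> n i) powr p"
            by (rule lp_norm_powr[OF p d, symmetric])
          also have "\<dots> \<le> \<epsilon> powr p"
            using M[OF m n] p lp_norm_nonneg by (intro powr_mono2) auto
          finally show ?thesis .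
        qed
        then show "\<exists>M. \<forall>n\<ge>M. (\<Sum>i<K. norm (\<sigma> m i - \<sigma> n i) powr p) \<le> \<epsilon> powr p"
          by blast
      qed
      then have s: "summable (\<lambda>i. norm (\<sigma> m i - x i) powr p)"
        by (intro summableI_nonneg_bounded[where x = "\<epsilon> powr p"]) auto
      then have d: "(\<lambda>i. \<sigma> m i - x i) \<in> lp_space p"
        by (simp add: lp_space_def)
      moreover have "lp_sum p (\<lambda>i. \<sigma> m i - x i) \<le> \<epsilon> powr p"
        unfolding lp_sum_def by (rule suminf_le_const[OF s partial])
      ultimately show ?thesis
        using \<open>\<epsilon> > 0\<close> by (auto intro: lp_norm_leI[OF p d])
    qed
    then show ?thesis
      by blast
  qed
  \<comment> \<open>The limit is recovered as \<open>\<sigma> m\<close> minus this difference, both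
    of which lie in the space.\<close>
  obtain m where "(\<lambda>i. \<sigma> m i - x i) \<in> lp_space p"
    using close[of 1] by auto
  then have "x \<in> lp_space p"
    using lp_diff_mem[OF p mem, of "\<lambda>i. \<sigma> m i - x i" m] by simp
  moreover have "(\<lambda>n. lp_norm p (\<lambda>i. \<sigma> n i - x i)) \<longlonglongrightarrow> 0"
  proof (rule metric_LIMSEQ_I)
    fix r :: real
    assume "r > 0"
    then obtain M where "\<And>m. m \<ge> M \<Longrightarrow> lp_norm p (\<lambda>i. \<sigma> m i - x i) \<le> r / 2"
      using close[of "r / 2"] by auto
    then have "dist (lp_norm p (\<lambda>i. \<sigma> m i - x i)) 0 < r" if "m \<ge> M" for m
      using that \<open>r > 0\<close> lp_norm_nonneg[of p "\<lambda>i. \<sigma> m i - x i"] by fastforce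
    then show "\<exists>M. \<forall>m\<ge>M. dist (lp_norm p (\<lambda>i. \<sigma> m i - x i)) 0 < r"
      by blast
  qed
  ultimately show ?thesis
    by blast
qed

lemma sequence_space_lp:
  assumes p: "1 \<le> p"
  shows "sequence_space (lp_space p) (lp_norm p)"
proof
  fix x y :: "nat \<Rightarrow> complex" and c m j
  show "unit_seq j \<in> lp_space p"
    unfolding lp_space_def mem_Collect_eq
    by (rule summable_finite[of "{j}"]) (auto simp: unit_seq_def)
  show "(\<lambda>n. x n + y n) \<in> lp_space p" "lp_norm p (\<lambda>n. x n + y n) \<le> lp_norm p x + lp_norm p y"
    if "x \<in> lp_space p" "y \<in> lp_space p"
    using lp_Minkowski[OF p that] by auto
  show "(\<lambda>n. c * x n) \<in> lp_space p" "lp_norm p (\<lambda>n. c * x n) = norm c * lp_norm p x"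
    if "x \<in> lp_space p"
    using lp_scale[OF p that] by auto
  show "0 \<le> lp_norm p x"
    by (rule lp_norm_nonneg)
  show "x = (\<lambda>_. 0)" if "x \<in> lp_space p" "lp_norm p x = 0"
    using lp_norm_eq_0[OF p that] .
  show "x \<in> lp_space p" "lp_norm p x \<le> lp_norm p y"
    if "y \<in> lp_space p" "\<And>n. norm (x n) \<le> norm (y n)"
    using lp_solid[OF p that] by auto
  show "(\<lambda>i. if i < m then 0 else x (i - m)) \<in> lp_space p" if "x \<in> lp_space p"
    by (rule lp_shift_right_mem[OF that])
  show "lp_norm p (\<lambda>i. if i < m then 0 else x (i - m)) \<le> lp_norm p x" if "x \<in> lp_space p"
    using lp_split_initial_segment(2)[OF lp_shift_right_mem[OF that, of m], of m]
    by (intro lp_norm_mono p lp_shift_right_mem that) simp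
  show "(\<lambda>i. x (i + m)) \<in> lp_space p" if "x \<in> lp_space p"
    by (rule lp_split_initial_segment(1)[OF that])
  show "lp_norm p (\<lambda>i. x (i + m)) \<le> lp_norm p x" if "x \<in> lp_space p"
    by (intro lp_norm_mono p lp_split_initial_segment(1) that)
       (simp add: lp_split_initial_segment(2)[OF that, of m] sum_nonneg)
  show "(\<lambda>n. lp_norm p (tail n x)) \<longlonglongrightarrow> 0" if x: "x \<in> lp_space p"
  proof -
    have "lp_sum p (tail n x) = lp_sum p x - (\<Sum>i<n. norm (x i) powr p)" for n
    proof -
      have "tail n x \<in> lp_space p"
        by (rule lp_solid(1)[OF p x]) (simp add: tail_def)
      from lp_split_initial_segment(2)[OF this, of n] lp_split_initial_segment(2)[OF x, of n]
      show ?thesis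
        by (simp add: tail_def)
    qed
    moreover have "(\<lambda>n. lp_sum p x - (\<Sum>i<n. norm (x i) powr p)) \<longlonglongrightarrow> lp_sum p x - lp_sum p x"
      unfolding lp_sum_def using x by (intro tendsto_diff tendsto_const summable_LIMSEQ) (simp add: lp_space_def)
    ultimately have "(\<lambda>n. lp_sum p (tail n x)) \<longlonglongrightarrow> 0"
      by simp
    moreover have "0 \<le> lp_sum p (tail n x)" for n
      by (rule lp_sum_nonneg[OF lp_solid(1)[OF p x]]) (simp add: tail_def)
    ultimately show ?thesis
      unfolding lp_norm_eq using p by (intro tendsto_zero_powrI[OF _ tendsto_const]) auto
  qed
  show "lp_norm p (\<lambda>i. u i + v i) \<le> lp_norm p (\<lambda>i. u' i + v' i)"
    if mem: "u \<in> lp_space p" "v \<in> lp_space p" "u' \<in> lp_space p" "v' \<in> lp_space p"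
      and disj: "\<And>i. u i = 0 \<or> v i = 0" "\<And>i. u' i = 0 \<or> v' i = 0"
      and le: "lp_norm p u \<le> lp_norm p u'" "lp_norm p v \<le> lp_norm p v'" for u v u' v'
  proof -
    \<comment> \<open>At each index one summand is 0 and contributes nothing, so p-th powers add
      exactly; this gives the monotonicity that \<open>norm_disjoint_add\<close> asks for.\<close>
    have add: "lp_sum p (\<lambda>i. a i + b i) = lp_sum p a + lp_sum p b"
      if "a \<in> lp_space p" "b \<in> lp_space p" "\<And>i. a i = 0 \<or> b i = 0" for a b
    proof -
      have "norm (a i + b i) powr p = norm (a i) powr p + norm (b i) powr p" for i
        using that(3)[of i] p by auto
      then show ?thesis
        using that by (simp add: lp_sum_def lp_space_def suminf_add)
    qed
    have mono: "lp_sum p a \<le> lp_sum p b" if "a \<in> lp_space p" "b \<in> lp_space p" "lp_norm p a \<le> lp_norm p b" for a b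
      using that p powr_mono2[of p "lp_norm p a" "lp_norm p b"] by (simp add: lp_norm_powr lp_norm_nonneg)
    have "lp_sum p (\<lambda>i. u i + v i) \<le> lp_sum p (\<lambda>i. u' i + v' i)"
      by (simp add: add mem disj add_mono mono le)
    then show ?thesis
      using lp_Minkowski[OF p mem(1,2)] by (intro lp_norm_mono p) auto
  qed
  show "\<exists>x\<in>lp_space p. (\<lambda>n. lp_norm p (\<lambda>i. \<sigma> n i - x i)) \<longlonglongrightarrow> 0"
    if "\<And>n. \<sigma> n \<in> lp_space p"
      "\<And>\<epsilon>. \<epsilon> > 0 \<Longrightarrow> \<exists>M. \<forall>m\<ge>M. \<forall>n\<ge>M. lp_norm p (\<lambda>i. \<sigma> m i - \<sigma> n i) < \<epsilon>" for \<sigma>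
    by (rule lp_complete[OF p that])
qed

section \<open>The space \<open>c0_space\<close>\<close>

lemma c0_coord_le:
  assumes "x \<in> c0_space"
  shows "norm (x n) \<le> c0_norm x"
proof -
  \<comment> \<open>Convergence makes the sequence bounded, without which the supremum would say
    nothing about single coordinates.\<close>
  have "Bseq x"
    using assms by (auto simp: c0_space_def intro: convergent_imp_Bseq convergentI)
  then have "bdd_above (range (\<lambda>n. norm (x n)))"
    by (auto simp: Bseq_def intro: bdd_aboveI)
  then show ?thesis
    unfolding c0_norm_def by (rule cSUP_upper[rotated]) simp
qed

lemma c0_norm_leI: "(\<And>n. norm (x n) \<le> c) \<Longrightarrow> c0_norm x \<le> c"
  unfolding c0_norm_def by (rule cSUP_least) auto

lemma c0_solid:
  assumes "y \<in> c0_space" "\<And>n. norm (x n) \<le> norm (y n)"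
  shows "x \<in> c0_space" "c0_norm x \<le> c0_norm y"
proof -
  have "(\<lambda>n. norm (y n)) \<longlonglongrightarrow> 0"
    using assms(1) by (simp add: c0_space_def tendsto_norm_zero)
  then show "x \<in> c0_space"
    unfolding c0_space_def mem_Collect_eq
    by (rule Lim_null_comparison[rotated]) (simp add: assms(2))
  show "c0_norm x \<le> c0_norm y"
    using assms c0_coord_le order_trans by (blast intro: c0_norm_leI)
qed

lemma c0_scale_le:
  assumes "x \<in> c0_space"
  shows "(\<lambda>n. c * x n) \<in> c0_space" "c0_norm (\<lambda>n. c * x n) \<le> norm c * c0_norm x"
proof -
  show "(\<lambda>n. c * x n) \<in> c0_space"
    using assms by (simp add: c0_space_def tendsto_mult_right_zero)
  show "c0_norm (\<lambda>n. c * x n) \<le> norm c * c0_norm x"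
    using assms by (intro c0_norm_leI) (simp add: norm_mult mult_left_mono c0_coord_le)
qed

lemma c0_diff_mem: "\<lbrakk>x \<in> c0_space; y \<in> c0_space\<rbrakk> \<Longrightarrow> (\<lambda>n. x n - y n) \<in> c0_space"
  unfolding c0_space_def using tendsto_diff[of x 0 sequentially y 0] by simp

text \<open>The supremum norm makes the coordinatewise convergence uniform, and a uniform limit of
  null sequences is a null sequence.\<close>

lemma c0_complete:
  assumes mem: "\<And>n. \<sigma> n \<in> c0_space"
    and cauchy: "\<And>\<epsilon>. \<epsilon> > 0 \<Longrightarrow> \<exists>M. \<forall>m\<ge>M. \<forall>n\<ge>M. c0_norm (\<lambda>i. \<sigma> m i - \<sigma> n i) < \<epsilon>"
  shows "\<exists>x\<in>c0_space. (\<lambda>n. c0_norm (\<lambda>i. \<sigma> n i - x i)) \<longlonglongrightarrow> 0"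
proof -
  have coord: "norm (\<sigma> m i - \<sigma> n i) \<le> c0_norm (\<lambda>i. \<sigma> m i - \<sigma> n i)" for m n i
    by (rule c0_coord_le[OF c0_diff_mem[OF mem mem]])
  have "Cauchy (\<lambda>n. \<sigma> n i)" for i
  proof (rule metric_CauchyI)
    fix \<epsilon> :: real
    assume "\<epsilon> > 0"
    then obtain M where "\<And>m n. \<lbrakk>m \<ge> M; n \<ge> M\<rbrakk> \<Longrightarrow> c0_norm (\<lambda>i. \<sigma> m i - \<sigma> n i) < \<epsilon>"
      using cauchy by blast
    then show "\<exists>M. \<forall>m\<ge>M. \<forall>n\<ge>M. dist (\<sigma> m i) (\<sigma> n i) < \<epsilon>"
      using coord[where i = i] unfolding dist_norm by (meson le_less_trans)
  qed
  then obtain x where x: "(\<lambda>n. \<sigma> n i) \<longlonglongrightarrow> x i" for i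
    unfolding Cauchy_convergent_iff convergent_def by metis
  have close: "\<exists>M. \<forall>m\<ge>M. \<forall>i. norm (\<sigma> m i - x i) \<le> \<epsilon>" if "\<epsilon> > 0" for \<epsilon>
  proof -
    obtain M where M: "\<And>m n. \<lbrakk>m \<ge> M; n \<ge> M\<rbrakk> \<Longrightarrow> c0_norm (\<lambda>i. \<sigma> m i - \<sigma> n i) < \<epsilon>"
      using cauchy[OF \<open>\<epsilon> > 0\<close>] by blast
    have "norm (\<sigma> m i - x i) \<le> \<epsilon>" if "m \<ge> M" for m i
    proof (rule LIMSEQ_le_const2)
      show "(\<lambda>n. norm (\<sigma> m i - \<sigma> n i)) \<longlonglongrightarrow> norm (\<sigma> m i - x i)"
        by (intro tendsto_intros x)
      show "\<exists>M. \<forall>n\<ge>M. norm (\<sigma> m i - \<sigma> n i) \<le> \<epsilon>"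
        using M[OF that] coord by (meson le_less_trans less_imp_le)
    qed
    then show ?thesis
      by blast
  qed
  have "x \<in> c0_space"
    unfolding c0_space_def mem_Collect_eq
  proof (rule metric_LIMSEQ_I)
    fix r :: real
    assume "r > 0"
    then obtain m where m: "\<And>i. norm (\<sigma> m i - x i) \<le> r / 2"
      using close[of "r / 2"] by auto
    have "\<sigma> m \<longlonglongrightarrow> 0"
      using mem[of m] by (simp add: c0_space_def)
    then obtain K where K: "\<And>i. i \<ge> K \<Longrightarrow> norm (\<sigma> m i) < r / 2"
      using LIMSEQ_D[of "\<sigma> m" 0 "r / 2"] \<open>r > 0\<close> by auto
    have "norm (x i) < r" if "i \<ge> K" for i
      using norm_triangle_ineq2[of "x i" "\<sigma> m i"] m[of i] K[OF that] by (simp add: norm_minus_commute)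
    then show "\<exists>K. \<forall>i\<ge>K. dist (x i) 0 < r"
      by auto
  qed
  \<comment> \<open>\<open>c0_norm\<close> is a bare supremum; its sign follows from a coordinate
    bound, which needs the difference to lie in the space.\<close>
  moreover from this have nonneg: "0 \<le> c0_norm (\<lambda>i. \<sigma> m i - x i)" for m
    using c0_coord_le[OF c0_diff_mem[OF mem], of x m 0] by (meson norm_ge_zero order_trans)
  have "(\<lambda>n. c0_norm (\<lambda>i. \<sigma> n i - x i)) \<longlonglongrightarrow> 0"
  proof (rule metric_LIMSEQ_I)
    fix r :: real
    assume "r > 0"
    then obtain M where M: "\<And>m i. m \<ge> M \<Longrightarrow> norm (\<sigma> m i - x i) \<le> r / 2"
      using close[of "r / 2"] by auto
    have "dist (c0_norm (\<lambda>i. \<sigma> m i - x i)) 0 < r" if "m \<ge> M" for m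
      using c0_norm_leI[of "\<lambda>i. \<sigma> m i - x i", OF M[OF that]] \<open>r > 0\<close> nonneg[of m] by simp
    then show "\<exists>M. \<forall>m\<ge>M. dist (c0_norm (\<lambda>i. \<sigma> m i - x i)) 0 < r"
      by blast
  qed
  ultimately show ?thesis
    by blast
qed

lemma sequence_space_c0: "sequence_space c0_space c0_norm"
proof
  fix x y :: "nat \<Rightarrow> complex" and c m j
  show "unit_seq j \<in> c0_space"
    unfolding c0_space_def mem_Collect_eq
    by (rule tendsto_eventually) (auto simp: unit_seq_def eventually_sequentially intro!: exI[of _ "Suc j"])
  show nonneg: "0 \<le> c0_norm x" if "x \<in> c0_space" for x
    using c0_coord_le[OF that, of 0] norm_ge_zero order_trans by blast
  show "(\<lambda>n. x n + y n) \<in> c0_space" if "x \<in> c0_space" "y \<in> c0_space"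
    using that tendsto_add[of x 0 sequentially y 0] by (simp add: c0_space_def)
  show "c0_norm (\<lambda>n. x n + y n) \<le> c0_norm x + c0_norm y" if "x \<in> c0_space" "y \<in> c0_space"
    by (intro c0_norm_leI norm_triangle_le add_mono c0_coord_le that)
  show "(\<lambda>n. c * x n) \<in> c0_space" if "x \<in> c0_space"
    by (rule c0_scale_le(1)[OF that])
  show "c0_norm (\<lambda>n. c * x n) = norm c * c0_norm x" if x: "x \<in> c0_space"
  proof (cases "c = 0")
    case True
    then show ?thesis
      by (simp add: c0_norm_def)
  next
    case False
    \<comment> \<open>The missing inequality is the one-sided bound applied to the factor
      \<open>inverse c\<close>.\<close>
    have "c0_norm (\<lambda>n. inverse c * (c * x n)) \<le> norm (inverse c) * c0_norm (\<lambda>n. c * x n)"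
      by (rule c0_scale_le(2)[OF c0_scale_le(1)[OF x]])
    then have "c0_norm x \<le> inverse (norm c) * c0_norm (\<lambda>n. c * x n)"
      using False by (simp add: norm_inverse mult.assoc[symmetric] del: inverse_eq_divide)
    then have "norm c * c0_norm x \<le> c0_norm (\<lambda>n. c * x n)"
      using False by (simp add: field_simps)
    then show ?thesis
      using c0_scale_le(2)[OF x, of c] by simp
  qed
  show "x = (\<lambda>_. 0)" if "x \<in> c0_space" "c0_norm x = 0"
    using c0_coord_le[OF that(1)] that(2) by (intro ext) simp
  show "x \<in> c0_space" "c0_norm x \<le> c0_norm y" if "y \<in> c0_space" "\<And>n. norm (x n) \<le> norm (y n)"
    using c0_solid[OF that] by auto
  show "(\<lambda>n. c0_norm (tail n x)) \<longlonglongrightarrow> 0" if x: "x \<in> c0_space"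
  proof (rule metric_LIMSEQ_I)
    fix r :: real
    assume "r > 0"
    have "x \<longlonglongrightarrow> 0"
      using x by (simp add: c0_space_def)
    then obtain K where K: "\<And>i. i \<ge> K \<Longrightarrow> norm (x i) < r / 2"
      using LIMSEQ_D[of x 0 "r / 2"] \<open>r > 0\<close> by auto
    have "dist (c0_norm (tail n x)) 0 < r" if "n \<ge> K" for n
    proof -
      have "c0_norm (tail n x) \<le> r / 2"
        using K that \<open>r > 0\<close> by (intro c0_norm_leI) (auto simp: tail_def intro: less_imp_le)
      moreover have "0 \<le> c0_norm (tail n x)"
        by (rule nonneg[OF c0_solid(1)[OF x]]) (simp add: tail_def)
      ultimately show ?thesis
        using \<open>r > 0\<close> by simp
    qed
    then show "\<exists>K. \<forall>n\<ge>K. dist (c0_norm (tail n x)) 0 < r"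
      by blast
  qed
  show "(\<lambda>i. if i < m then 0 else x (i - m)) \<in> c0_space" if "x \<in> c0_space"
    unfolding c0_space_def mem_Collect_eq
    by (rule LIMSEQ_offset[where k = m]) (use that in \<open>simp add: c0_space_def\<close>)
  show "c0_norm (\<lambda>i. if i < m then 0 else x (i - m)) \<le> c0_norm x" if "x \<in> c0_space"
    using c0_coord_le[OF that] nonneg[OF that] by (intro c0_norm_leI) auto
  show "(\<lambda>i. x (i + m)) \<in> c0_space" if "x \<in> c0_space"
    using that by (simp add: c0_space_def LIMSEQ_ignore_initial_segment)
  show "c0_norm (\<lambda>i. x (i + m)) \<le> c0_norm x" if "x \<in> c0_space"
    by (intro c0_norm_leI c0_coord_le that)
  show "c0_norm (\<lambda>i. u i + v i) \<le> c0_norm (\<lambda>i. u' i + v' i)"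
    if mem: "u \<in> c0_space" "v \<in> c0_space" "u' \<in> c0_space" "v' \<in> c0_space"
      and disj: "\<And>i. u i = 0 \<or> v i = 0" "\<And>i. u' i = 0 \<or> v' i = 0"
      and le: "c0_norm u \<le> c0_norm u'" "c0_norm v \<le> c0_norm v'" for u v u' v'
  proof -
    let ?s = "\<lambda>i. u' i + v' i"
    have s: "?s \<in> c0_space"
      using mem tendsto_add[of u' 0 sequentially v' 0] by (simp add: c0_space_def)
    \<comment> \<open>By disjointness \<open>u'\<close> and \<open>v'\<close> are each dominated
      coordinatewise by their sum, so solidity applies.\<close>
    have u': "c0_norm u' \<le> c0_norm ?s" and v': "c0_norm v' \<le> c0_norm ?s"
      by (rule c0_solid(2)[OF s], use disj(2) in \<open>metis add.right_neutral add.left_neutral norm_ge_zero norm_zero order_refl\<close>)+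
    have "norm (u i + v i) \<le> c0_norm ?s" for i
      using disj(1)[of i] c0_coord_le[OF mem(1), of i] c0_coord_le[OF mem(2), of i] le u' v' by auto
    then show ?thesis
      by (rule c0_norm_leI)
  qed
  show "\<exists>x\<in>c0_space. (\<lambda>n. c0_norm (\<lambda>i. \<sigma> n i - x i)) \<longlonglongrightarrow> 0"
    if "\<And>n. \<sigma> n \<in> c0_space"
      "\<And>\<epsilon>. \<epsilon> > 0 \<Longrightarrow> \<exists>M. \<forall>m\<ge>M. \<forall>n\<ge>M. c0_norm (\<lambda>i. \<sigma> m i - \<sigma> n i) < \<epsilon>" for \<sigma>
    by (rule c0_complete[OF that])
qed

theorem proposition2p1:
  fixes X :: "(nat \<Rightarrow> complex) set" and N :: "(nat \<Rightarrow> complex) \<Rightarrow> real"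
  assumes "(\<exists>p::real. 1 \<le> p \<and> X = lp_space p \<and> N = lp_norm p) \<or>
           (X = c0_space \<and> N = c0_norm)"
  shows "typical_contraction X N
           (\<lambda>T. (\<forall>\<mu>. dense_range X N (minus_scalar X T \<mu>)) \<and>
                op_spectrum X N T = closure (ball 0 1) \<and>
                approx_point_spectrum X N T = closure (ball 0 1))"
proof -
  have "sequence_space X N"
    using assms sequence_space_lp sequence_space_c0 by auto
  then show ?thesis
    by (rule sequence_space.typical_contraction_spectrum)
qed

end
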